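(* Consider a finite classical polar space of rank $n\ge 3$ over $\mathbb{F}_q$ with parameter $e\in\{0,\frac12,1,\frac32,2\}$. Let $J\subseteq\{1,\dots,n\}$ and let $v$ be the total number of flags of type $J$. Let $C$ be the set of all flags of type $J$ satisfying one (fixed) of the following conditions: (i) $1\in J$, and the point of the flag lies in a fixed generator; (ii) $n\in J$, and $e\ge1$ or $n$ is even, and the generator of the flag contains a fixed point; (iii) $n\in J$, $e=0$, $n$ is odd, and the generator of the flag belongs to a fixed one of the two classes of generators. Then $C$ is an EKR-set of flags of type $J$ that meets the upper bound $M$ for the size of EKR-sets of flags of type $J$, i.e. $|C|=M$, where $M=\dfrac{v}{1+q^{n+e-1}}$, except when $e\le\frac12$, $n\in J$ and $n$ is odd, in which case $M=\dfrac{v}{1+q^{n/2}}$ for $e=\frac12$ and $M=\dfrac v2$ for $e=0$.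
   Context: The finite classical polar spaces of rank $n$ over $\mathbb{F}_q$, with their group $G$ and parameter $e$, are: hyperbolic quadric, $G=\mathrm{PGO}^+(2n,q)$ (full group), $e=0$; hermitian polar space, $G=\mathrm{PGU}(2n,q)$, $q$ a square, $e=\frac12$; symplectic polar space, $G=\mathrm{PSp}(2n,q)$, or parabolic quadric, $G=\mathrm{PGO}(2n+1,q)$, $e=1$; hermitian polar space, $G=\mathrm{PGU}(2n+1,q)$, $q$ a square, $e=\frac32$; elliptic quadric, $G=\mathrm{PGO}^-(2n+2,q)$, $e=2$. The field of definition is $\mathbb{F}_q$ in all cases. The subspaces of the polar space are the nonzero totally isotropic (totally singular) subspaces; the type of a subspace is its vector space dimension, in $\{1,\dots,n\}$; subspaces of type $1$ are called points and subspaces of type $n$ are called generators. For the hyperbolic quadric ($e=0$) the generators fall into two classes of equal size, two generators $N_1,N_2$ being in the same class iff $\dim(N_1\cap N_2)\equiv n\pmod 2$. A flag is a set of subspaces pairwise comparable by inclusion; its type is the set of types of its members. Two points are collinear if they span a totally isotropic (singular) subspace. A polar frame is a set of $2n$ points $\{e_{-n},\dots,e_{-1},e_1,\dots,e_n\}$ such that each $e_i$ is collinear with all points of the set except $e_{-i}$. Fix a polar frame and let $F=\{\langle e_1\rangle,\langle e_1,e_2\rangle,\dots,\langle e_1,\dots,e_n\rangle\}$ with stabilizer $B$ in $G$; $G$ is transitive on maximal flags. The Weyl group $W$ of type $B_n$ is the group of permutations of $\{\pm1,\dots,\pm n\}$ generated by $s_i=(i,i+1)(-i,-i-1)$, $1\le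 i\le n-1$, and $t=(-n,n)$; it acts on the frame by permuting indices, and this action is induced by elements of $G$. Its longest element is $w_0=(-n,n)\cdots(-1,1)$. Two maximal flags $gF,hF$ are opposite if $Bh^{-1}gB=Bw_0B$. Two flags of the same type $J$ are opposite if they can be extended to two opposite maximal flags. An EKR-set of flags of type $J$ is a set of flags of type $J$ no two of which are opposite.
   Formalization: For condition (i), |C|=M is claimed only outside the case e≤1/2, n∈J, n odd, where it is false (e.g. e=0, q=2, n=3, J={1,3}: |C|=42 but M=105); in that case only the EKR property of (i) is asserted. *)

theory Defs
  imports "HOL-Analysis.Analysis"
begin

text \<open>
  The ground field is a finite field \<open>'a\<close>, so \<open>q = CARD('a)\<close>, and the ambient vector space is
  \<open>'a ^ 'd\<close>. A subspace of the polar space is represented by its set of vectors. In the hermitian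
  cases \<open>q\<close> is the order of the field over which the space is defined, not that of the subfield
  fixed by the involution.
\<close>

section \<open>Forms\<close>

datatype ('a, 'v) form =
    Alternating "'v \<Rightarrow> 'v \<Rightarrow> 'a"
  | Hermitian "'v \<Rightarrow> 'v \<Rightarrow> 'a"
  | Quadratic "'v \<Rightarrow> 'a"

definition bilinear_form :: "('a::field ^ 'd::finite \<Rightarrow> 'a ^ 'd \<Rightarrow> 'a) \<Rightarrow> bool" where
  "bilinear_form b \<longleftrightarrow>
     (\<forall>v. Vector_Spaces.linear (*s) (*) (\<lambda>u. b u v)) \<and>
     (\<forall>u. Vector_Spaces.linear (*s) (*) (\<lambda>v. b u v))"

definition alternating_form :: "('a::field ^ 'd::finite \<Rightarrow> 'a ^ 'd \<Rightarrow> 'a) \<Rightarrow> bool" where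
  "alternating_form b \<longleftrightarrow> bilinear_form b \<and> (\<forall>v. b v v = 0)"

text \<open>For \<open>q = r\<^sup>2\<close> the involutory field automorphism is \<open>x \<mapsto> x\<^sup>r\<close>. Semilinearity in the second
  argument follows from the other conditions.\<close>

definition hermitian_form :: "('a::{field,finite} ^ 'd::finite \<Rightarrow> 'a ^ 'd \<Rightarrow> 'a) \<Rightarrow> bool" where
  "hermitian_form h \<longleftrightarrow>
     (\<exists>r. CARD('a) = r\<^sup>2 \<and>
        (\<forall>v. Vector_Spaces.linear (*s) (*) (\<lambda>u. h u v)) \<and>
        (\<forall>u v. h v u = h u v ^ r))"

definition polarization :: "('v::ab_group_add \<Rightarrow> 'a::field) \<Rightarrow> 'v \<Rightarrow> 'v \<Rightarrow> 'a" where
  "polarization Q u v = Q (u + v) - Q u - Q v"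

definition quadratic_form :: "('a::field ^ 'd::finite \<Rightarrow> 'a) \<Rightarrow> bool" where
  "quadratic_form Q \<longleftrightarrow>
     (\<forall>c v. Q (c *s v) = c\<^sup>2 * Q v) \<and> bilinear_form (polarization Q)"

text \<open>A quadratic form is nondegenerate if no nonzero \<^emph>\<open>singular\<close> vector lies in the radical of its
  polarization; this is the condition that is right in characteristic 2 as well, where in odd
  dimension the radical of the polarization is never zero.\<close>

fun nondegenerate :: "('a::field, 'a ^ 'd::finite) form \<Rightarrow> bool" where
  "nondegenerate (Alternating b) \<longleftrightarrow> (\<forall>v. (\<forall>u. b v u = 0) \<longrightarrow> v = 0)"
| "nondegenerate (Hermitian h) \<longleftrightarrow> (\<forall>v. (\<forall>u. h v u = 0) \<longrightarrow> v = 0)"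
| "nondegenerate (Quadratic Q) \<longleftrightarrow> (\<forall>v. Q v = 0 \<and> (\<forall>u. polarization Q v u = 0) \<longrightarrow> v = 0)"

fun totally_singular :: "('a::field, 'a ^ 'd::finite) form \<Rightarrow> ('a ^ 'd) set \<Rightarrow> bool" where
  "totally_singular (Alternating b) U \<longleftrightarrow> (\<forall>u\<in>U. \<forall>v\<in>U. b u v = 0)"
| "totally_singular (Hermitian h) U \<longleftrightarrow> (\<forall>u\<in>U. \<forall>v\<in>U. h u v = 0)"
| "totally_singular (Quadratic Q) U \<longleftrightarrow> (\<forall>u\<in>U. Q u = 0)"

fun preserves_form :: "('a, 'v) form \<Rightarrow> ('v \<Rightarrow> 'v) \<Rightarrow> bool" where
  "preserves_form (Alternating b) f \<longleftrightarrow> (\<forall>u v. b (f u) (f v) = b u v)"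
| "preserves_form (Hermitian h) f \<longleftrightarrow> (\<forall>u v. h (f u) (f v) = h u v)"
| "preserves_form (Quadratic Q) f \<longleftrightarrow> (\<forall>v. Q (f v) = Q v)"

definition isometry :: "('a::field, 'a ^ 'd::finite) form \<Rightarrow> ('a ^ 'd \<Rightarrow> 'a ^ 'd) \<Rightarrow> bool" where
  "isometry \<Phi> f \<longleftrightarrow> Vector_Spaces.linear (*s) (*s) f \<and> bij f \<and> preserves_form \<Phi> f"

section \<open>Finite classical polar spaces\<close>

definition witt_index :: "('a::{field,finite}, 'a ^ 'd::finite) form \<Rightarrow> nat" where
  "witt_index \<Phi> = Max {vec.dim U |U. vec.subspace U \<and> totally_singular \<Phi> U}"

datatype polar_kind =
  Hyperbolic | Hermitian_Even | Symplectic | Parabolic | Hermitian_Odd | Elliptic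

fun polar_e :: "polar_kind \<Rightarrow> real" where
  "polar_e Hyperbolic = 0"
| "polar_e Hermitian_Even = 1 / 2"
| "polar_e Symplectic = 1"
| "polar_e Parabolic = 1"
| "polar_e Hermitian_Odd = 3 / 2"
| "polar_e Elliptic = 2"

definition classical_polar_space ::
  "polar_kind \<Rightarrow> nat \<Rightarrow> ('a::{field,finite}, 'a ^ 'd::finite) form \<Rightarrow> bool" where
  "classical_polar_space k n \<Phi> \<longleftrightarrow>
     nondegenerate \<Phi> \<and> witt_index \<Phi> = n \<and>
     (case (k, \<Phi>) of
        (Hyperbolic, Quadratic Q) \<Rightarrow> quadratic_form Q \<and> CARD('d) = 2 * n
      | (Hermitian_Even, Hermitian h) \<Rightarrow> hermitian_form h \<and> CARD('d) = 2 * n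
      | (Symplectic, Alternating b) \<Rightarrow> alternating_form b \<and> CARD('d) = 2 * n
      | (Parabolic, Quadratic Q) \<Rightarrow> quadratic_form Q \<and> CARD('d) = 2 * n + 1
      | (Hermitian_Odd, Hermitian h) \<Rightarrow> hermitian_form h \<and> CARD('d) = 2 * n + 1
      | (Elliptic, Quadratic Q) \<Rightarrow> quadratic_form Q \<and> CARD('d) = 2 * n + 2
      | _ \<Rightarrow> False)"

definition polar_subspaces :: "('a::field, 'a ^ 'd::finite) form \<Rightarrow> ('a ^ 'd) set set" where
  "polar_subspaces \<Phi> = {U. vec.subspace U \<and> U \<noteq> {0} \<and> totally_singular \<Phi> U}"

definition polar_points :: "('a::field, 'a ^ 'd::finite) form \<Rightarrow> ('a ^ 'd) set set" where
  "polar_points \<Phi> = {U \<in> polar_subspaces \<Phi>. vec.dim U = 1}"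

definition generators :: "('a::field, 'a ^ 'd::finite) form \<Rightarrow> nat \<Rightarrow> ('a ^ 'd) set set" where
  "generators \<Phi> n = {U \<in> polar_subspaces \<Phi>. vec.dim U = n}"

text \<open>Only used for the hyperbolic quadric, where this is an equivalence relation with two classes.\<close>

definition generator_classes ::
  "('a::field, 'a ^ 'd::finite) form \<Rightarrow> nat \<Rightarrow> ('a ^ 'd) set set set" where
  "generator_classes \<Phi> n =
     generators \<Phi> n //
       {(N1, N2). N1 \<in> generators \<Phi> n \<and> N2 \<in> generators \<Phi> n \<and>
          vec.dim (N1 \<inter> N2) mod 2 = n mod 2}"

definition collinear_points ::
  "('a::field, 'a ^ 'd::finite) form \<Rightarrow> ('a ^ 'd) set \<Rightarrow> ('a ^ 'd) set \<Rightarrow> bool" where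
  "collinear_points \<Phi> P R \<longleftrightarrow> totally_singular \<Phi> (vec.span (P \<union> R))"

section \<open>Flags\<close>

definition is_flag :: "('a::field, 'a ^ 'd::finite) form \<Rightarrow> ('a ^ 'd) set set \<Rightarrow> bool" where
  "is_flag \<Phi> f \<longleftrightarrow> f \<subseteq> polar_subspaces \<Phi> \<and> (\<forall>U\<in>f. \<forall>V\<in>f. U \<subseteq> V \<or> V \<subseteq> U)"

definition flag_type :: "('a::field ^ 'd::finite) set set \<Rightarrow> nat set" where
  "flag_type f = vec.dim ` f"

definition flags :: "('a::field, 'a ^ 'd::finite) form \<Rightarrow> nat set \<Rightarrow> ('a ^ 'd) set set set" where
  "flags \<Phi> J = {f. is_flag \<Phi> f \<and> flag_type f = J}"

section \<open>The group and opposition\<close>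

text \<open>The projective isometry group (PGO, PGU or PSp): the permutations of the lattice of all
  subspaces of \<open>'a ^ 'd\<close> that are induced by isometries. Taking the identity on sets that are not
  subspaces makes isometries that differ by a scalar induce the same permutation.\<close>

definition polar_group ::
  "('a::field, 'a ^ 'd::finite) form \<Rightarrow> (('a ^ 'd) set \<Rightarrow> ('a ^ 'd) set) set" where
  "polar_group \<Phi> = {\<lambda>U. if vec.subspace U then f ` U else U |f. isometry \<Phi> f}"

definition frame_indices :: "nat \<Rightarrow> int set" where
  "frame_indices n = {- int n..int n} - {0}"

definition polar_frame ::
  "('a::field, 'a ^ 'd::finite) form \<Rightarrow> nat \<Rightarrow> (int \<Rightarrow> ('a ^ 'd) set) \<Rightarrow> bool" where
  "polar_frame \<Phi> n fr \<longleftrightarrow>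
     inj_on fr (frame_indices n) \<and>
     fr ` frame_indices n \<subseteq> polar_points \<Phi> \<and>
     (\<forall>i\<in>frame_indices n. \<forall>j\<in>frame_indices n.
        collinear_points \<Phi> (fr i) (fr j) \<longleftrightarrow> j \<noteq> - i)"

definition frame_flag ::
  "nat \<Rightarrow> (int \<Rightarrow> ('a::field ^ 'd::finite) set) \<Rightarrow> ('a ^ 'd) set set" where
  "frame_flag n fr = {vec.span (\<Union>j\<in>{1..int i}. fr j) |i. i \<in> {1..n}}"

definition borel_subgroup ::
  "('a::field, 'a ^ 'd::finite) form \<Rightarrow> nat \<Rightarrow> (int \<Rightarrow> ('a ^ 'd) set) \<Rightarrow>
     (('a ^ 'd) set \<Rightarrow> ('a ^ 'd) set) set" where
  "borel_subgroup \<Phi> n fr = {g \<in> polar_group \<Phi>. g ` frame_flag n fr = frame_flag n fr}"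

definition double_coset :: "('x \<Rightarrow> 'x) set \<Rightarrow> ('x \<Rightarrow> 'x) \<Rightarrow> ('x \<Rightarrow> 'x) set" where
  "double_coset B g = {b1 \<circ> g \<circ> b2 |b1 b2. b1 \<in> B \<and> b2 \<in> B}"

text \<open>The longest element \<open>(-n,n)\<dots>(-1,1)\<close> of the Weyl group of type \<open>B\<^sub>n\<close> is negation of indices;
  \<open>w\<close> below is an element of the group inducing it on the frame. Any two such elements differ by
  an element fixing every frame point, hence lying in \<open>B\<close>, so the double coset does not depend on
  the choice of \<open>w\<close>.\<close>

definition opposite_maximal_flags ::
  "('a::field, 'a ^ 'd::finite) form \<Rightarrow> nat \<Rightarrow> (int \<Rightarrow> ('a ^ 'd) set) \<Rightarrow>
     ('a ^ 'd) set set \<Rightarrow> ('a ^ 'd) set set \<Rightarrow> bool" where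
  "opposite_maximal_flags \<Phi> n fr F1 F2 \<longleftrightarrow>
     (let B = borel_subgroup \<Phi> n fr; F = frame_flag n fr in
      \<exists>g\<in>polar_group \<Phi>. \<exists>h\<in>polar_group \<Phi>. \<exists>w\<in>polar_group \<Phi>.
        F1 = g ` F \<and> F2 = h ` F \<and>
        (\<forall>i\<in>frame_indices n. w (fr i) = fr (- i)) \<and>
        double_coset B (inv h \<circ> g) = double_coset B w)"

definition opposite_flags ::
  "('a::field, 'a ^ 'd::finite) form \<Rightarrow> nat \<Rightarrow> (int \<Rightarrow> ('a ^ 'd) set) \<Rightarrow>
     ('a ^ 'd) set set \<Rightarrow> ('a ^ 'd) set set \<Rightarrow> bool" where
  "opposite_flags \<Phi> n fr f1 f2 \<longleftrightarrow>
     flag_type f1 = flag_type f2 \<and>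
     (\<exists>F1 F2. f1 \<subseteq> F1 \<and> f2 \<subseteq> F2 \<and> opposite_maximal_flags \<Phi> n fr F1 F2)"

definition EKR_set ::
  "('a::field, 'a ^ 'd::finite) form \<Rightarrow> nat \<Rightarrow> (int \<Rightarrow> ('a ^ 'd) set) \<Rightarrow> nat set \<Rightarrow>
     ('a ^ 'd) set set set \<Rightarrow> bool" where
  "EKR_set \<Phi> n fr J C \<longleftrightarrow>
     C \<subseteq> flags \<Phi> J \<and> pairwise (\<lambda>f1 f2. \<not> opposite_flags \<Phi> n fr f1 f2) C"

section \<open>The bound and the examples\<close>

text \<open>In the exceptional case the bound is larger than \<open>v / (1 + q powr (n + e - 1))\<close>, which is always
  the size of the set of flags whose point lies in a given generator; so that example attains the
  bound only outside the exceptional case. For example, with \<open>n = 3\<close>, \<open>q = 2\<close>, \<open>e = 0\<close> and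
  \<open>J = {1, 3}\<close> there are 210 flags, the bound is 105, and that set has 42 members.\<close>

definition exceptional_case :: "polar_kind \<Rightarrow> nat \<Rightarrow> nat set \<Rightarrow> bool" where
  "exceptional_case k n J \<longleftrightarrow> polar_e k \<le> 1 / 2 \<and> n \<in> J \<and> odd n"

definition EKR_bound ::
  "polar_kind \<Rightarrow> nat \<Rightarrow> ('a::{field,finite}, 'a ^ 'd::finite) form \<Rightarrow> nat set \<Rightarrow> real" where
  "EKR_bound k n \<Phi> J =
     (let q = real CARD('a); e = polar_e k; v = real (card (flags \<Phi> J)) in
      if exceptional_case k n J
      then (if e = 0 then v / 2 else v / (1 + q powr (real n / 2)))
      else v / (1 + q powr (real n + e - 1)))"

definition flags_point_in ::
  "('a::field, 'a ^ 'd::finite) form \<Rightarrow> nat set \<Rightarrow> ('a ^ 'd) set \<Rightarrow> ('a ^ 'd) set set set" where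
  "flags_point_in \<Phi> J N = {f \<in> flags \<Phi> J. \<exists>P\<in>f. P \<in> polar_points \<Phi> \<and> P \<subseteq> N}"

definition flags_generator_through ::
  "('a::field, 'a ^ 'd::finite) form \<Rightarrow> nat \<Rightarrow> nat set \<Rightarrow> ('a ^ 'd) set \<Rightarrow>
     ('a ^ 'd) set set set" where
  "flags_generator_through \<Phi> n J P = {f \<in> flags \<Phi> J. \<exists>N\<in>f. N \<in> generators \<Phi> n \<and> P \<subseteq> N}"

definition flags_generator_in_class ::
  "('a::field, 'a ^ 'd::finite) form \<Rightarrow> nat \<Rightarrow> nat set \<Rightarrow> ('a ^ 'd) set set \<Rightarrow>
     ('a ^ 'd) set set set" where
  "flags_generator_in_class \<Phi> n J K = {f \<in> flags \<Phi> J. \<exists>N\<in>f. N \<in> generators \<Phi> n \<and> N \<in> K}"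

end

theory Submission
  imports Defs
begin

text \<open>Sizes are compared by counting bases. Call a sequence \<open>(u\<^sub>1, \<dots>, u\<^sub>n)\<close> adapted to a flag if it is
a basis of a generator whose initial segments span the members of the flag. A sequence is adapted to
exactly one flag of type \<open>J\<close>, and the number of sequences adapted to a flag depends only on \<open>J\<close>: if
\<open>u\<^sub>1, \<dots>, u\<^sub>j\<close> are chosen, the next vector ranges over the smallest member of dimension \<open>> j\<close>, or,
if there is none, over the singular vectors orthogonal to \<open>\<langle>u\<^sub>1, \<dots>, u\<^sub>j\<rangle>\<close>, always minus
\<open>\<langle>u\<^sub>1, \<dots>, u\<^sub>j\<rangle>\<close>. So the proportion of flags of type \<open>J\<close> with a property equals a proportion
of sequences (\<open>card_flags_times\<close>).

The number of singular vectors in \<open>U\<^sup>\<bottom>\<close>, for \<open>U\<close> totally singular, is found by averaging over the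
cosets of a generator \<open>N \<supseteq> U\<close>: in \<open>N\<^sup>\<bottom>\<close> only the vectors of \<open>N\<close> are singular, and every other
coset \<open>v + N\<close> has the same number \<open>\<theta> |N|\<close> of singular vectors (\<open>card_singular_perp\<close>). In particular
there are \<open>(q\<^sup>n - 1) (1 + q powr (n + e - 1))\<close> nonzero singular vectors.

\<^item> The point of a flag lies in the generator \<open>N\<close> iff \<open>u\<^sub>1 \<in> N\<close>; each nonzero singular vector is the
  first of equally many sequences, so the proportion is \<open>1 / (1 + q powr (n + e - 1))\<close>.
\<^item> Every point lies on the same number of generators, and counting incident pairs gives the same
  proportion for the generators through a fixed point.
\<^item> On a hyperbolic quadric a totally singular subspace of dimension \<open>n - 1\<close> lies on exactly two
  generators, and these meet any third generator in dimensions that differ by one. Hence being in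
  the same class is an equivalence, and each such subspace lies on one generator of each class, so
  that the two classes have the same size.

For the EKR property, unfolding the double coset condition shows that a pair of opposite maximal
flags is the image under an isometry of the pair of flags spanned by \<open>e\<^bsub>-1\<^esub>, e\<^bsub>-2\<^esub>, \<dots>\<close> and
by \<open>e\<^sub>1, e\<^sub>2, \<dots>\<close> (\<open>opposite_maximal_flags_imp_isometry\<close>). So opposite points are not collinear, while
points of one generator are, and opposite generators meet trivially, while generators through a
common point do not and, for odd \<open>n\<close>, generators of the same class have odd-dimensional
intersection.\<close>

section \<open>Finite fields\<close>

lemma card_as_sum_of_fibres:
  assumes "finite A" "finite B" "f ` A \<subseteq> B"
  shows "card A = (\<Sum>c\<in>B. card {a \<in> A. f a = c})"
  using sum.group[OF assms, of "\<lambda>_. 1::nat"] by simp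

text \<open>Multiplication by \<open>x \<noteq> 0\<close> permutes the nonzero elements; compare the products of all of them.\<close>

lemma power_card_field: "(x::'a::{field,finite}) ^ CARD('a) = x"
proof (cases "x = 0")
  case False
  let ?U = "UNIV - {0::'a}"
  have "bij_betw ((*) x) ?U ?U"
    using False by (intro bij_betwI[where g = "\<lambda>y. y / x"]) auto
  then have "prod (\<lambda>y. x * y) ?U = prod (\<lambda>y. y) ?U"
    by (rule prod.reindex_bij_betw)
  then have "x ^ card ?U * \<Prod>?U = \<Prod>?U"
    by (simp add: prod.distrib)
  then have "x ^ card ?U = 1"
    by simp
  moreover have "CARD('a) = Suc (card ?U)"
    by (metis card.remove UNIV_I finite)
  ultimately show ?thesis
    by (metis mult_1_right power_Suc)
qed (use finite_UNIV_card_ge_0[where 'a = 'a] in simp)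

lemma CHAR_prime_finite_field: "prime CHAR('a::{field,finite})"
  by (intro prime_CHAR_semidom finite_imp_CHAR_pos finite)

text \<open>A largest subset \<open>A\<close> of \<open>p\<close>-power order that is closed under addition is everything: for \<open>x \<notin> A\<close> the
sums \<open>a + i x\<close> with \<open>0 \<le> i < p\<close> would form a larger one.\<close>

lemma card_field_prime_power: "\<exists>s. CARD('a::{field,finite}) = CHAR('a) ^ s"
proof -
  let ?p = "CHAR('a)"
  have p: "prime ?p" by (rule CHAR_prime_finite_field)
  define closed where
    "closed A \<longleftrightarrow> (0::'a) \<in> A \<and> (\<forall>x\<in>A. \<forall>y\<in>A. x + y \<in> A) \<and> (\<exists>s. card A = ?p ^ s)" for A
  have "closed {0}"
    by (auto simp: closed_def intro!: exI[of _ 0])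
  then have ne: "card ` Collect closed \<noteq> {}" by auto
  have fin: "finite (card ` Collect closed)" by simp
  obtain A where A: "closed A" and "card A = Max (card ` Collect closed)"
    using Max_in[OF fin ne] by auto
  then have A_max: "\<And>B. closed B \<Longrightarrow> card B \<le> card A"
    using Max_ge[OF fin] by auto
  have A0: "0 \<in> A" and A_add: "\<And>x y. x \<in> A \<Longrightarrow> y \<in> A \<Longrightarrow> x + y \<in> A"
    using A by (auto simp: closed_def)
  have A_mult: "of_nat k * x \<in> A" if "x \<in> A" for k x
    by (induction k) (use that A0 A_add in \<open>auto simp: algebra_simps\<close>)
  have A_minus: "- x \<in> A" if "x \<in> A" for x
  proof -
    have "of_nat (?p - 1) * x = - x"
      using prime_ge_1_nat[OF p] by (simp only: of_nat_diff of_nat_CHAR) simp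
    then show ?thesis using A_mult[OF that] by metis
  qed
  have "A = UNIV"
  proof (rule ccontr)
    assume "A \<noteq> UNIV"
    then obtain x where x: "x \<notin> A" by auto
    let ?f = "\<lambda>(a, i). a + of_nat i * x"
    have neq: False
      if "a \<in> A" "b \<in> A" "i < j" "j < ?p" "a + of_nat i * x = b + of_nat j * x" for a b i j
    proof -
      have d: "of_nat (j - i) * x \<in> A"
      proof -
        have "of_nat (j - i) * x = a + - b"
          using that(3,5) by (simp add: of_nat_diff algebra_simps)
        then show ?thesis
          using A_add[OF \<open>a \<in> A\<close> A_minus[OF \<open>b \<in> A\<close>]] by simp
      qed
      have "coprime (j - i) ?p"
        using p that by (metis coprime_commute diff_is_0_eq leD less_imp_diff_less nat_dvd_not_less
            neq0_conv prime_imp_coprime_nat)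
      then obtain k l where "(j - i) * k = ?p * l + 1"
        using bezout_nat[of "j - i" ?p] \<open>i < j\<close>
        by (metis coprime_iff_gcd_eq_1 not_less_zero zero_less_diff neq0_conv)
      then have "of_nat ((j - i) * k) = (1::'a)"
        by simp
      then have "of_nat k * (of_nat (j - i) * x) = x"
        by (metis mult.assoc mult.commute mult_1 of_nat_mult)
      then show False using A_mult[OF d] x by metis
    qed
    have "inj_on ?f (A \<times> {..<?p})"
    proof (rule inj_onI, clarsimp)
      fix a i b j assume h: "a \<in> A" "i < ?p" "b \<in> A" "j < ?p" "a + of_nat i * x = b + of_nat j * x"
      then have "i = j" using neq[of a b i j] neq[of b a j i] by (metis linorder_neqE_nat)
      then show "a = b \<and> i = j" using h by simp
    qed
    then have card: "card (?f ` (A \<times> {..<?p})) = card A * ?p"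
      by (simp add: card_image)
    have "closed (?f ` (A \<times> {..<?p}))"
      unfolding closed_def
    proof (intro conjI ballI)
      show "0 \<in> ?f ` (A \<times> {..<?p})"
        using A0 p by (intro image_eqI[of _ _ "(0, 0)"]) (auto simp: prime_gt_0_nat)
      show "\<exists>s. card (?f ` (A \<times> {..<?p})) = ?p ^ s"
        using A unfolding card closed_def by (metis power_Suc2)
      fix y z assume "y \<in> ?f ` (A \<times> {..<?p})" "z \<in> ?f ` (A \<times> {..<?p})"
      then obtain a i b j where *: "a \<in> A" "b \<in> A" "y = a + of_nat i * x" "z = b + of_nat j * x"
        by auto
      have "y + z = (a + b) + of_nat (i + j) * x"
        using * by (simp add: algebra_simps)
      also have "of_nat (i + j) = (of_nat ((i + j) mod ?p) :: 'a)"
      proof -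
        have "of_nat (i + j) = (of_nat (?p * ((i + j) div ?p) + (i + j) mod ?p) :: 'a)"
          by (simp only: mult_div_mod_eq)
        then show ?thesis
          by (simp only: of_nat_add of_nat_mult of_nat_CHAR) simp
      qed
      finally show "y + z \<in> ?f ` (A \<times> {..<?p})"
        using A_add[OF *(1,2)] p
        by (intro image_eqI[of _ _ "(a + b, (i + j) mod ?p)"]) (auto simp: prime_gt_0_nat)
    qed
    from A_max[OF this] have "card A * ?p \<le> card A" unfolding card .
    moreover have "card A > 0" using A0 by (auto simp: card_gt_0_iff)
    ultimately show False using prime_gt_1_nat[OF p] by simp
  qed
  then show ?thesis using A by (auto simp: closed_def)
qed

text \<open>As \<open>r\<close> divides a power of the characteristic, \<open>x \<mapsto> x\<^sup>r\<close> is a power of the Frobenius map.\<close>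

lemma power_add_sqrt_card:
  fixes x y :: "'a::{field,finite}"
  assumes "CARD('a) = r\<^sup>2"
  shows "(x + y) ^ r = x ^ r + y ^ r"
proof -
  obtain s where "r\<^sup>2 = CHAR('a) ^ s"
    using card_field_prime_power[where 'a = 'a] assms by auto
  then have "r dvd CHAR('a) ^ s"
    by (metis dvd_triv_left power2_eq_square)
  then obtain t where "r = CHAR('a) ^ t"
    using divides_primepow_nat[OF CHAR_prime_finite_field] by blast
  then show ?thesis
    by (rule freshmans_dream'[OF CHAR_prime_finite_field])
qed

text \<open>The additive map \<open>x \<mapsto> x + x\<^sup>r\<close> takes values in the fixed field \<open>{c. c\<^sup>r = c}\<close>. Its kernel and the
fixed field are both zero sets of polynomials of degree \<open>r\<close>, while the product of the sizes of kernel
and image is \<open>r\<^sup>2\<close>; so both have exactly \<open>r\<close> elements.\<close>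

lemma card_trace_fibre:
  fixes c :: "'a::{field,finite}"
  assumes q: "CARD('a) = r\<^sup>2" and c: "c ^ r = c"
  shows "card {x. x + x ^ r = c} = r"
proof -
  let ?t = "\<lambda>x::'a. x + x ^ r"
  let ?K = "{x. ?t x = 0}" and ?R = "{c::'a. c ^ r = c}"
  have "CARD('a) > 1"
    using card_mono[of UNIV "{0, 1::'a}"] by simp
  then have r: "r > 1"
    using q by (cases "r = 0"; cases "r = 1") auto
  have roots: "card {x. poly p x = 0} \<le> r" if "degree p = r" for p :: "'a poly"
    using card_poly_roots_bound[of p] that r by force
  have K: "card ?K \<le> r"
    using roots[of "monom 1 r + monom 1 1"] r
    by (simp add: poly_monom degree_add_eq_left degree_monom_eq add.commute)
  have R: "card ?R \<le> r"
    using roots[of "monom 1 r + monom (- 1) 1"] r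
    by (simp add: poly_monom degree_add_eq_left degree_monom_eq)
  have tR: "range ?t \<subseteq> ?R"
  proof safe
    fix x :: 'a
    have "(x + x ^ r) ^ r = x ^ r + x ^ (r\<^sup>2)"
      by (simp add: power_add_sqrt_card[OF q] power2_eq_square flip: power_mult)
    then show "(x + x ^ r) ^ r = x + x ^ r"
      using power_card_field[of x] q by simp
  qed
  have fib: "card {x. ?t x = d} = card ?K" if d: "d \<in> range ?t" for d
  proof -
    obtain y where y: "?t y = d" using d by blast
    have "bij_betw (\<lambda>x. x + y) ?K {x. ?t x = d}"
    proof (rule bij_betwI[where g = "\<lambda>x. x - y"])
      have t_add: "?t (u + v) = ?t u + ?t v" for u v
        by (simp only: power_add_sqrt_card[OF q] ac_simps)
      show "(\<lambda>x. x - y) \<in> {x. ?t x = d} \<rightarrow> ?K"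
      proof (intro Pi_I CollectI)
        fix x assume "x \<in> {x. ?t x = d}"
        moreover have "?t x = ?t (x - y) + d"
          using t_add[of "x - y" y] unfolding y diff_add_cancel .
        ultimately show "?t (x - y) = 0" by (simp only: mem_Collect_eq) simp
      qed
      show "(\<lambda>x. x + y) \<in> ?K \<rightarrow> {x. ?t x = d}"
      proof (intro Pi_I CollectI)
        fix x assume "x \<in> ?K"
        then show "?t (x + y) = d" unfolding t_add y by simp
      qed
    qed auto
    then show ?thesis by (rule bij_betw_same_card[symmetric])
  qed
  have "r\<^sup>2 = (\<Sum>d\<in>range ?t. card {x. ?t x = d})"
    using card_as_sum_of_fibres[of UNIV "range ?t" ?t] q by simp
  also have "\<dots> = card (range ?t) * card ?K"
    using fib by simp
  finally have eq: "r * r = card (range ?t) * card ?K"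
    by (simp add: power2_eq_square)
  have le: "card (range ?t) \<le> card ?R" using tR by (intro card_mono) auto
  have "card (range ?t) = r" "card ?K = r"
  proof -
    have "card (range ?t) * card ?K \<le> card (range ?t) * r" "card (range ?t) * card ?K \<le> r * card ?K"
      using K R le by (auto intro: mult_le_mono)
    then have "r * r \<le> card (range ?t) * r" "r * r \<le> r * card ?K" using eq by auto
    then show "card (range ?t) = r" "card ?K = r"
      using r K R le by auto
  qed
  then have "range ?t = ?R"
    using tR R le by (intro card_subset_eq) auto
  moreover have "c \<in> ?R"
    using c by blast
  ultimately have "c \<in> range ?t"
    by (simp only:)
  from fib[OF this] \<open>card ?K = r\<close> show ?thesis
    by (simp only:)
qed

section \<open>Counting vectors\<close>

lemma two_le_card_field: "2 \<le> CARD('a::{field,finite})"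
  using card_mono[of UNIV "{0, 1::'a}"] by simp

lemma card_span_insert:
  fixes x :: "'a::{field,finite} ^ 'd::finite"
  assumes "x \<notin> vec.span X"
  shows "card (vec.span (insert x X)) = CARD('a) * card (vec.span X)"
proof -
  let ?f = "\<lambda>(c, u). c *s x + u"
  have "inj_on ?f (UNIV \<times> vec.span X)"
  proof (rule inj_onI, clarsimp)
    fix c d u v assume h: "u \<in> vec.span X" "v \<in> vec.span X" "c *s x + u = d *s x + v"
    then have "(c - d) *s x = v - u"
      by (simp add: vec.scale_left_diff_distrib algebra_simps)
    then have "(c - d) *s x \<in> vec.span X"
      using h by (simp add: vec.span_diff)
    then have "inverse (c - d) *s ((c - d) *s x) \<in> vec.span X"
      by (rule vec.span_scale)
    moreover have "inverse (c - d) *s ((c - d) *s x) = x" if "c \<noteq> d"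
      using that by (simp only: vec.scale_scale left_inverse right_minus_eq vec.scale_one) simp
    ultimately have "c = d"
      using assms by metis
    then show "c = d \<and> u = v" using h by simp
  qed
  moreover have "?f ` (UNIV \<times> vec.span X) = vec.span (insert x X)"
  proof
    show "?f ` (UNIV \<times> vec.span X) \<subseteq> vec.span (insert x X)"
    proof (clarsimp, rule vec.span_add)
      fix c u assume "u \<in> vec.span X"
      then show "u \<in> vec.span (insert x X)"
        using vec.span_mono[of X "insert x X"] by auto
      show "c *s x \<in> vec.span (insert x X)"
        by (intro vec.span_scale vec.span_base) simp
    qed
    show "vec.span (insert x X) \<subseteq> ?f ` (UNIV \<times> vec.span X)"
    proof
      fix v assume "v \<in> vec.span (insert x X)"
      then obtain c where "v - c *s x \<in> vec.span X" by (auto simp: vec.span_insert)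
      then show "v \<in> ?f ` (UNIV \<times> vec.span X)"
        by (intro image_eqI[of _ _ "(c, v - c *s x)"]) auto
    qed
  qed
  ultimately show ?thesis
    by (metis card_cartesian_product card_image)
qed

lemma card_subspace:
  fixes U :: "('a::{field,finite} ^ 'd::finite) set"
  assumes "vec.subspace U"
  shows "card U = CARD('a) ^ vec.dim U"
proof -
  have "card (vec.span X) = CARD('a) ^ card X" if "vec.independent X" for X :: "('a ^ 'd) set"
    using finite[of X] that
  proof (induction X)
    case (insert x X)
    have "x \<notin> vec.span X" "vec.independent X"
      using insert.prems insert.hyps(2) by (auto simp: vec.independent_insert)
    then show ?case
      using insert by (simp add: card_span_insert)
  qed simp
  then show ?thesis
    using vec.basis_exists[of U] assms vec.span_subspace by metis
qed

text \<open>Translation by a suitable multiple of \<open>u0\<close> carries any fibre of the functional to any other one.\<close>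

lemma card_functional_fibre:
  fixes U :: "('a::{field,finite} ^ 'd::finite) set"
  assumes f: "Vector_Spaces.linear (*s) (*) f" and U: "vec.subspace U"
    and u0: "u0 \<in> U" "f u0 \<noteq> 0"
  shows "CARD('a) * card {u \<in> U. f u = c} = card U"
proof -
  interpret f: Vector_Spaces.linear "(*s)" "(*)" f by (rule f)
  have "card {u \<in> U. f u = d} = card {u \<in> U. f u = c}" for d :: 'a
  proof (rule bij_betw_same_card[OF bij_betwI])
    let ?w = "((c - d) / f u0) *s u0"
    have w: "?w \<in> U" "f ?w = c - d"
      using u0 U by (auto simp: vec.subspace_scale f.scale)
    show "(\<lambda>u. u + ?w) \<in> {u \<in> U. f u = d} \<rightarrow> {u \<in> U. f u = c}"
      using w U by (auto simp: f.add vec.subspace_add)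
    show "(\<lambda>u. u - ?w) \<in> {u \<in> U. f u = c} \<rightarrow> {u \<in> U. f u = d}"
      using w U by (auto simp: f.diff vec.subspace_diff)
  qed auto
  then have "(\<Sum>d\<in>UNIV. card {u \<in> U. f u = d}) = (\<Sum>d\<in>(UNIV :: 'a set). card {u \<in> U. f u = c})"
    by (intro sum.cong) auto
  then show ?thesis
    using card_as_sum_of_fibres[of U UNIV f] by simp
qed

lemma span_of_subspace: "vec.subspace U \<Longrightarrow> vec.span U = U"
  by simp

lemma subset_sums_left:
  fixes A B :: "'v::ab_group_add set"
  assumes "0 \<in> B"
  shows "A \<subseteq> {x + y |x y. x \<in> A \<and> y \<in> B}"
proof
  fix a assume "a \<in> A"
  then have "a = a + 0 \<and> a \<in> A \<and> 0 \<in> B" using assms by simp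
  then show "a \<in> {x + y |x y. x \<in> A \<and> y \<in> B}" by blast
qed

lemma subset_sums_right:
  fixes A B :: "'v::ab_group_add set"
  assumes "0 \<in> A"
  shows "B \<subseteq> {x + y |x y. x \<in> A \<and> y \<in> B}"
proof
  fix b assume "b \<in> B"
  then have "b = 0 + b \<and> 0 \<in> A \<and> b \<in> B" using assms by simp
  then show "b \<in> {x + y |x y. x \<in> A \<and> y \<in> B}" by blast
qed

section \<open>Totally singular subspaces\<close>

text \<open>The setting shared by the three kinds of forms: \<open>B\<close> is the alternating or hermitian form or the
polarization of the quadratic form, and \<open>S\<close> holds of the singular vectors. The number \<open>\<theta>\<close> is the
proportion of singular vectors in a coset \<open>v + U\<close> of a totally singular subspace \<open>U\<close> that is not
orthogonal to \<open>v\<close>; it is \<open>1\<close> for an alternating, \<open>1 / q\<close> for a quadratic and \<open>1 / sqrt q\<close> for a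
hermitian form. The form enters the counts below only through \<open>\<theta>\<close>. Linearity is asked for in the first
argument and symmetry for the orthogonality relation, which covers hermitian forms as well.\<close>

locale singular_geometry =
  fixes B :: "'a::{field,finite} ^ 'd::finite \<Rightarrow> 'a ^ 'd \<Rightarrow> 'a"
    and S :: "'a ^ 'd \<Rightarrow> bool"
    and \<theta> :: real
  assumes linear_left: "Vector_Spaces.linear (*s) (*) (\<lambda>u. B u v)"
    and orthogonal_sym: "B u v = 0 \<Longrightarrow> B v u = 0"
    and S_zero: "S 0"
    and S_scale: "S v \<Longrightarrow> S (c *s v)"
    and S_add: "S u \<Longrightarrow> S v \<Longrightarrow> B u v = 0 \<Longrightarrow> S (u + v)"
    and S_isotropic: "S v \<Longrightarrow> B v v = 0"
    and S_radical: "S v \<Longrightarrow> (\<And>u. B v u = 0) \<Longrightarrow> v = 0"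
    and theta_nonneg: "0 \<le> \<theta>"
    and card_singular_coset:
      "vec.subspace U \<Longrightarrow> (\<And>u. u \<in> U \<Longrightarrow> S u) \<Longrightarrow> u0 \<in> U \<Longrightarrow> B u0 v \<noteq> 0 \<Longrightarrow>
         real (card {u \<in> U. S (v + u)}) = \<theta> * real (card U)"
begin

definition perp :: "('a ^ 'd) set \<Rightarrow> ('a ^ 'd) set" where
  "perp X = {v. \<forall>u\<in>X. B v u = 0}"

definition tot_sing :: "('a ^ 'd) set \<Rightarrow> bool" where
  "tot_sing U \<longleftrightarrow> vec.subspace U \<and> (\<forall>u\<in>U. S u) \<and> U \<subseteq> perp U"

lemma card_field_gt_1: "1 < CARD('a)"
  using two_le_card_field[where 'a = 'a] by simp

lemma B_zero_left [simp]: "B 0 v = 0"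
  and B_add_left: "B (u + w) v = B u v + B w v"
  and B_scale_left: "B (c *s u) v = c * B u v"
proof -
  interpret f: Vector_Spaces.linear "(*s)" "(*)" "\<lambda>u. B u v" by (rule linear_left)
  show "B 0 v = 0" "B (u + w) v = B u v + B w v" "B (c *s u) v = c * B u v"
    by (rule f.zero f.add f.scale)+
qed

lemma subspace_perp: "vec.subspace (perp X)"
  by (auto simp: perp_def vec.subspace_def B_add_left B_scale_left)

lemma perp_antimono: "X \<subseteq> Y \<Longrightarrow> perp Y \<subseteq> perp X"
  by (auto simp: perp_def)

lemma subset_perp_sym: "X \<subseteq> perp Y \<longleftrightarrow> Y \<subseteq> perp X"
  using orthogonal_sym by (fastforce simp: perp_def)

lemma perp_span: "perp (vec.span X) = perp X"
proof
  show "perp (vec.span X) \<subseteq> perp X"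
    by (intro perp_antimono vec.span_superset)
  have "vec.span X \<subseteq> perp (perp X)"
    by (intro vec.span_minimal subspace_perp) (subst subset_perp_sym, simp)
  then show "perp X \<subseteq> perp (vec.span X)"
    by (subst subset_perp_sym)
qed

lemma tot_singD:
  assumes "tot_sing U"
  shows "vec.subspace U" "u \<in> U \<Longrightarrow> S u" "U \<subseteq> perp U"
  using assms by (auto simp: tot_sing_def)

lemma tot_sing_subset:
  assumes "tot_sing U" "vec.subspace V" "V \<subseteq> U"
  shows "tot_sing V"
  using assms perp_antimono[of V U] by (auto simp: tot_sing_def)

lemma tot_sing_zero: "tot_sing {0}"
  by (auto simp: tot_sing_def S_zero perp_def)

lemma tot_sing_sum:
  assumes U: "tot_sing U" and V: "tot_sing V" and UV: "V \<subseteq> perp U"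
  shows "tot_sing {x + y |x y. x \<in> U \<and> y \<in> V}"
proof -
  have UV': "U \<subseteq> perp V" using UV subset_perp_sym by blast
  have "S (x + y)" if "x \<in> U" "y \<in> V" for x y
    using that U V UV' by (intro S_add) (auto simp: tot_sing_def perp_def)
  moreover have "x + y \<in> perp {x + y |x y. x \<in> U \<and> y \<in> V}" if "x \<in> U" "y \<in> V" for x y
  proof -
    have *: "B w x = 0" "B w y = 0" if "w \<in> U \<union> V" "x \<in> U" "y \<in> V" for w x y
      using that U V UV UV' by (auto simp: tot_sing_def perp_def)
    have "B (a + b) w = 0" if "a \<in> U" "b \<in> V" "w \<in> U \<union> V" for a b w
      using *[of a _ _] *[of b _ _] that by (auto simp: B_add_left)
    then have "B (a + b) (x + y) = 0" if "a \<in> U" "b \<in> V" for a b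
      using that \<open>x \<in> U\<close> \<open>y \<in> V\<close>
      by (metis B_add_left UnI1 UnI2 add.right_neutral orthogonal_sym)
    then show ?thesis using orthogonal_sym by (auto simp: perp_def)
  qed
  ultimately show ?thesis
    using vec.subspace_sums[OF tot_singD(1)[OF U] tot_singD(1)[OF V]]
    by (auto simp: tot_sing_def)
qed

lemma tot_sing_insert:
  assumes U: "tot_sing U" and x: "S x" "x \<in> perp U"
  shows "tot_sing (vec.span (insert x U))"
proof -
  have "x \<in> perp {x}"
    using x by (simp add: perp_def S_isotropic)
  then have "{x} \<subseteq> perp (vec.span {x})"
    by (simp add: perp_span)
  then have "vec.span {x} \<subseteq> perp (vec.span {x})"
    by (metis perp_span subset_perp_sym)
  then have X: "tot_sing (vec.span {x})"
    using x vec.subspace_span[of "{x}"] by (auto simp: tot_sing_def vec.span_singleton S_scale)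
  have "vec.span {x} \<subseteq> perp U"
    using x by (intro vec.span_minimal subspace_perp) auto
  moreover have "vec.span U = U"
    using tot_singD(1)[OF U] by (simp add: vec.span_eq_iff)
  then have "vec.span (insert x U) = {a + b |a b. a \<in> U \<and> b \<in> vec.span {x}}"
    using vec.span_Un[of U "{x}"] by (simp only: Un_insert_right Un_empty_right)
  ultimately show ?thesis
    using tot_sing_sum[OF U X] by (simp only:)
qed

text \<open>For each \<open>a\<close>, either all vectors of \<open>U\<close> are orthogonal to \<open>a\<close>, or a fraction \<open>1 / q\<close> of them.\<close>

lemma card_orthogonal_pairs:
  assumes A: "vec.subspace A" and U: "vec.subspace U"
  shows "CARD('a) * card {(a, u). a \<in> A \<and> u \<in> U \<and> B u a = 0} =
         card U * (card A + (CARD('a) - 1) * card (A \<inter> perp U))"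
proof -
  have fibre: "CARD('a) * card {u \<in> U. B u a = 0} = (if a \<in> perp U then CARD('a) * card U else card U)" for a
  proof (cases "a \<in> perp U")
    case True
    then have "{u \<in> U. B u a = 0} = U"
      using orthogonal_sym by (auto simp: perp_def)
    then show ?thesis using True by simp
  next
    case False
    then obtain u where "u \<in> U" "B u a \<noteq> 0"
      using orthogonal_sym by (auto simp: perp_def)
    then show ?thesis
      using card_functional_fibre[OF linear_left U, of u a 0] False by simp
  qed
  have "{(a, u). a \<in> A \<and> u \<in> U \<and> B u a = 0} = (SIGMA a:A. {u \<in> U. B u a = 0})"
    by auto
  then have "CARD('a) * card {(a, u). a \<in> A \<and> u \<in> U \<and> B u a = 0} = (\<Sum>a\<in>A. CARD('a) * card {u \<in> U. B u a = 0})"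
    by (simp add: card_SigmaI sum_distrib_left)
  also have "\<dots> = (\<Sum>a\<in>A. card U + (if a \<in> perp U then (CARD('a) - 1) * card U else 0))"
    using card_field_gt_1 by (intro sum.cong) (auto simp: fibre algebra_simps diff_mult_distrib)
  also have "\<dots> = card U * (card A + (CARD('a) - 1) * card (A \<inter> perp U))"
    by (simp add: sum.distrib sum.If_cases algebra_simps Int_def)
  finally show ?thesis .
qed

text \<open>Both sides of \<open>card_orthogonal_pairs\<close>, for \<open>(A, U)\<close> and for \<open>(U, A)\<close>, count the same pairs. This replaces
the duality between subspaces and their annihilators, and it does so without semilinear algebra for
the second argument of a hermitian form.\<close>

lemma card_perp_duality:
  assumes A: "vec.subspace A" and U: "vec.subspace U"
  shows "card (A \<inter> perp U) * card U = card A * card (U \<inter> perp A)"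
proof -
  have "bij_betw prod.swap {(a, u). a \<in> A \<and> u \<in> U \<and> B u a = 0} {(u, a). u \<in> U \<and> a \<in> A \<and> B a u = 0}"
    by (rule bij_betwI[where g = prod.swap]) (auto intro: orthogonal_sym)
  from bij_betw_same_card[OF this] have "card U * (card A + (CARD('a) - 1) * card (A \<inter> perp U)) =
      card A * (card U + (CARD('a) - 1) * card (U \<inter> perp A))"
    by (simp only: card_orthogonal_pairs[OF A U, symmetric] card_orthogonal_pairs[OF U A, symmetric])
  then have "(CARD('a) - 1) * (card (A \<inter> perp U) * card U) = (CARD('a) - 1) * (card A * card (U \<inter> perp A))"
    by (simp add: algebra_simps)
  then show ?thesis using card_field_gt_1 by simp
qed

lemma dim_perp_duality:
  assumes A: "vec.subspace A" and U: "vec.subspace U"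
  shows "vec.dim (A \<inter> perp U) + vec.dim U = vec.dim A + vec.dim (U \<inter> perp A)"
proof -
  have "CARD('a) ^ (vec.dim (A \<inter> perp U) + vec.dim U) = CARD('a) ^ (vec.dim A + vec.dim (U \<inter> perp A))"
    using card_perp_duality[OF A U] A U
    by (simp add: card_subspace subspace_perp vec.subspace_inter power_add)
  then show ?thesis using card_field_gt_1 by (simp add: power_inject_exp)
qed

text \<open>Duality for the whole space and \<open>U\<close>: no nonzero vector of \<open>U\<close> is orthogonal to all vectors, even if the
radical of \<open>B\<close> is nonzero, as happens for quadratic forms in characteristic 2.\<close>

lemma card_perp:
  assumes "tot_sing U"
  shows "card (perp U) = CARD('a) ^ (CARD('d) - vec.dim U)"
proof -
  have "U \<inter> perp UNIV = {0}"
    using tot_singD[OF assms] S_radical by (auto simp: perp_def vec.subspace_0)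
  then have "vec.dim (perp U) + vec.dim U = CARD('d)"
    using dim_perp_duality[OF vec.subspace_UNIV tot_singD(1)[OF assms]]
    by (simp add: card_cart_basis)
  then have "vec.dim (perp U) = CARD('d) - vec.dim U" by simp
  then show ?thesis by (simp add: card_subspace subspace_perp)
qed

end

text \<open>The Witt index \<open>n\<close> is the largest dimension of a totally singular subspace; the subspaces of that
dimension are the generators.\<close>

locale singular_geometry_of_rank = singular_geometry B S \<theta>
  for B :: "'a::{field,finite} ^ 'd::finite \<Rightarrow> 'a ^ 'd \<Rightarrow> 'a" and S :: "'a ^ 'd \<Rightarrow> bool" and \<theta> :: real +
  fixes n :: nat
  assumes dim_tot_sing_le: "tot_sing U \<Longrightarrow> vec.dim U \<le> n"
    and ex_gen: "\<exists>N. tot_sing N \<and> vec.dim N = n"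
begin

definition gens :: "('a ^ 'd) set set" where
  "gens = {N. tot_sing N \<and> vec.dim N = n}"

lemma gensD:
  assumes "N \<in> gens"
  shows "tot_sing N" "vec.dim N = n" "vec.subspace N" "card N = CARD('a) ^ n"
  using assms tot_singD by (auto simp: gens_def card_subspace)

text \<open>The subspace \<open>U + (U\<^sup>\<bottom> \<inter> N)\<close> is totally singular, and by duality it has dimension at least \<open>n\<close>. It is the
source of all generators constructed here: it shows that every totally singular subspace lies in a
generator, and it produces generators that share prescribed subspaces with \<open>N\<close>.\<close>

lemma join_in_gens:
  assumes U: "tot_sing U" and N: "N \<in> gens"
  shows "{x + y |x y. x \<in> U \<and> y \<in> perp U \<inter> N} \<in> gens"
proof -
  note N' = gensD[OF N]
  let ?J = "{x + y |x y. x \<in> U \<and> y \<in> perp U \<inter> N}"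
  have ts: "tot_sing (perp U \<inter> N)"
    using tot_sing_subset[OF N'(1)] N' by (simp add: vec.subspace_inter subspace_perp)
  then have J: "tot_sing ?J"
    by (intro tot_sing_sum U) auto
  have "vec.dim ?J + vec.dim (U \<inter> (perp U \<inter> N)) = vec.dim U + vec.dim (perp U \<inter> N)"
    by (rule vec.dim_sums_Int[OF tot_singD(1)[OF U] tot_singD(1)[OF ts]])
  moreover have "U \<inter> (perp U \<inter> N) = U \<inter> N"
    using tot_singD(3)[OF U] by auto
  moreover have "vec.dim (N \<inter> perp U) + vec.dim U = n + vec.dim (U \<inter> perp N)"
    using dim_perp_duality[OF N'(3) tot_singD(1)[OF U]] N' by simp
  moreover have "vec.dim (U \<inter> N) \<le> vec.dim (U \<inter> perp N)"
    using tot_singD(3)[OF N'(1)] by (intro vec.dim_subset) auto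
  ultimately have "n \<le> vec.dim ?J"
    by (simp add: Int_commute)
  then show ?thesis
    using J dim_tot_sing_le[OF J] by (auto simp: gens_def)
qed

lemma ex_gens_superset:
  assumes U: "tot_sing U"
  shows "\<exists>N\<in>gens. U \<subseteq> N"
proof -
  obtain N where N: "N \<in> gens" using ex_gen by (auto simp: gens_def)
  have "0 \<in> perp U \<inter> N"
    using gensD(3)[OF N] subspace_perp[of U] by (auto simp: vec.subspace_0)
  then have "U \<subseteq> {x + y |x y. x \<in> U \<and> y \<in> perp U \<inter> N}"
    by (metis (mono_tags, lifting) add.right_neutral mem_Collect_eq subsetI)
  then show ?thesis using join_in_gens[OF U N] by blast
qed

lemma gens_maximal:
  assumes N: "N \<in> gens" and w: "S w" "w \<in> perp N"
  shows "w \<in> N"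
proof (rule ccontr)
  assume "w \<notin> N"
  then have "vec.dim (vec.span (insert w N)) = n + 1"
    using gensD[OF N] by (simp add: vec.dim_insert span_of_subspace)
  then show False
    using dim_tot_sing_le[OF tot_sing_insert[OF gensD(1)[OF N] w]] by simp
qed

lemma rank_le_dim: "n \<le> CARD('d)"
  using ex_gen dim_subset_UNIV_cart_gen by metis

text \<open>The number of singular vectors in \<open>U\<^sup>\<bottom>\<close> for a totally singular subspace \<open>U\<close> of dimension \<open>j\<close>.\<close>

definition sing_perp_count :: "nat \<Rightarrow> real" where
  "sing_perp_count j = real CARD('a) ^ n + \<theta> * (real CARD('a) ^ (CARD('d) - j) - real CARD('a) ^ (CARD('d) - n))"

text \<open>Fix a generator \<open>N \<supseteq> U\<close>. Averaging over the translates \<open>v + N\<close> of the vectors \<open>v\<close> of \<open>U\<^sup>\<bottom> - N\<^sup>\<bottom>\<close> shows that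
a fraction \<open>\<theta>\<close> of these vectors is singular; the singular vectors of \<open>N\<^sup>\<bottom>\<close> are those of \<open>N\<close>.\<close>

lemma card_singular_perp:
  assumes U: "tot_sing U"
  shows "real (card {w \<in> perp U. S w}) = sing_perp_count (vec.dim U)"
proof -
  obtain N where N: "N \<in> gens" and UN: "U \<subseteq> N" using ex_gens_superset[OF U] by blast
  note N' = gensD[OF N]
  have NN: "N \<subseteq> perp N" and NU: "perp N \<subseteq> perp U"
    using tot_singD(3)[OF N'(1)] perp_antimono[OF UN] by auto
  let ?W = "perp U - perp N"
  \<comment> \<open>the pairs \<open>(v, u)\<close> with \<open>v + u\<close> singular, counted once by \<open>v\<close> and once by \<open>v + u\<close>\<close>
  have "bij_betw (\<lambda>(v, u). (v + u, u)) (SIGMA v:?W. {u \<in> N. S (v + u)}) ({w \<in> ?W. S w} \<times> N)"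
  proof (rule bij_betwI[where g = "\<lambda>(v, u). (v - u, u)"])
    have closed: "v + u \<in> perp X \<longleftrightarrow> v \<in> perp X" if "u \<in> perp X" for u v X
      using that vec.subspace_add[OF subspace_perp] vec.subspace_diff[OF subspace_perp]
      by (metis add_diff_cancel)
    have *: "v + u \<in> ?W \<longleftrightarrow> v \<in> ?W" if "u \<in> N" for u v
      using closed[of u U v] closed[of u N v] that NN NU by blast
    have **: "v - u \<in> ?W" if "u \<in> N" "v \<in> ?W" for u v
      using *[OF that(1), of "v - u"] that(2) by (simp only: diff_add_cancel)
    show "(\<lambda>(v, u). (v + u, u)) \<in> (SIGMA v:?W. {u \<in> N. S (v + u)}) \<rightarrow> {w \<in> ?W. S w} \<times> N"
    proof (rule Pi_I)
      fix p assume "p \<in> (SIGMA v:?W. {u \<in> N. S (v + u)})"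
      then obtain v u where p: "p = (v, u)" "v \<in> ?W" "u \<in> N" "S (v + u)"
        by blast
      then show "(case p of (v, u) \<Rightarrow> (v + u, u)) \<in> {w \<in> ?W. S w} \<times> N"
        using *[of u v] by simp
    qed
    show "(\<lambda>(v, u). (v - u, u)) \<in> {w \<in> ?W. S w} \<times> N \<rightarrow> (SIGMA v:?W. {u \<in> N. S (v + u)})"
    proof (rule Pi_I)
      fix p assume "p \<in> {w \<in> ?W. S w} \<times> N"
      then obtain v u where p: "p = (v, u)" "v \<in> ?W" "u \<in> N" "S v"
        by blast
      then show "(case p of (v, u) \<Rightarrow> (v - u, u)) \<in> (SIGMA v:?W. {u \<in> N. S (v + u)})"
        using **[of u v] by simp
    qed
  qed auto
  from bij_betw_same_card[OF this]
  have "card (SIGMA v:?W. {u \<in> N. S (v + u)}) = card {w \<in> ?W. S w} * card N"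
    by (simp only: card_cartesian_product)
  moreover have "card (SIGMA v:?W. {u \<in> N. S (v + u)}) = (\<Sum>v\<in>?W. card {u \<in> N. S (v + u)})"
    by (rule card_SigmaI) auto
  ultimately have "real (card {w \<in> ?W. S w} * card N) = (\<Sum>v\<in>?W. real (card {u \<in> N. S (v + u)}))"
    by (simp only: flip: of_nat_sum)
  also have "\<dots> = (\<Sum>v\<in>?W. \<theta> * card N)"
  proof (intro sum.cong refl)
    fix v assume "v \<in> ?W"
    then obtain u where "u \<in> N" "B u v \<noteq> 0"
      using orthogonal_sym by (auto simp: perp_def)
    then show "real (card {u \<in> N. S (v + u)}) = \<theta> * card N"
      using card_singular_coset[OF N'(3)] tot_singD(2)[OF N'(1)] by blast
  qed
  also have "\<dots> = real (card ?W) * (\<theta> * card N)"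
    by simp
  finally have "real (card {w \<in> ?W. S w}) * card N = real (card ?W) * \<theta> * card N"
    by simp
  then have W: "real (card {w \<in> ?W. S w}) = \<theta> * card ?W"
    using card_field_gt_1 N' by simp
  have "card ?W = card (perp U) - card (perp N)"
    using NU by (simp add: card_Diff_subset)
  then have "real (card ?W) = real CARD('a) ^ (CARD('d) - vec.dim U) - real CARD('a) ^ (CARD('d) - n)"
    using NU card_mono[OF finite NU] by (simp add: card_perp U N' of_nat_diff)
  moreover have "{w \<in> perp U. S w} = N \<union> {w \<in> ?W. S w}"
    using gens_maximal[OF N] NN NU tot_singD(2)[OF N'(1)] by auto
  moreover have "N \<inter> {w \<in> ?W. S w} = {}"
    using NN by auto
  ultimately show ?thesis
    using W N' by (simp add: card_Un_disjoint sing_perp_count_def)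
qed

end

section \<open>Adapted bases of flags\<close>

text \<open>For a linearly independent list of length at least \<open>dim U\<close> for all members \<open>U\<close>, this says that initial
segments of the list span the members, by comparison of dimensions. For a shorter list it says that
the list can still be continued to such a list.\<close>

definition adapted :: "('a::field ^ 'd::finite) set set \<Rightarrow> ('a ^ 'd) list \<Rightarrow> bool" where
  "adapted f ws \<longleftrightarrow> (\<forall>U\<in>f. set (take (vec.dim U) ws) \<subseteq> U)"

definition flag_of :: "nat set \<Rightarrow> ('a::field ^ 'd::finite) list \<Rightarrow> ('a ^ 'd) set set" where
  "flag_of J ws = (\<lambda>i. vec.span (set (take i ws))) ` J"

lemma adapted_snoc:
  "adapted f (ws @ [x]) \<longleftrightarrow> adapted f ws \<and> (\<forall>U\<in>f. length ws < vec.dim U \<longrightarrow> x \<in> U)"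
proof -
  have "set (take m (ws @ [x])) \<subseteq> U \<longleftrightarrow> set (take m ws) \<subseteq> U \<and> (length ws < m \<longrightarrow> x \<in> U)" for m U
    by (cases "length ws < m") auto
  then show ?thesis by (auto simp: adapted_def)
qed

lemma adapted_take:
  assumes "adapted f ws"
  shows "adapted f (take k ws)"
proof -
  have "set (take m (take k ws)) \<subseteq> set (take m ws)" for m
    by (simp add: set_take_subset_set_take)
  then show ?thesis using assms by (fastforce simp: adapted_def)
qed

context singular_geometry_of_rank
begin

text \<open>Linear independence is expressed by the dimension of the span.\<close>

definition sing_basis :: "('a ^ 'd) list \<Rightarrow> bool" where
  "sing_basis ws \<longleftrightarrow> tot_sing (vec.span (set ws)) \<and> vec.dim (vec.span (set ws)) = length ws"

definition gen_bases :: "('a ^ 'd) list set" where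
  "gen_bases = {ws. length ws = n \<and> sing_basis ws}"

definition typed_flags :: "nat set \<Rightarrow> ('a ^ 'd) set set set" where
  "typed_flags J = {f. (\<forall>U\<in>f. tot_sing U) \<and> (\<forall>U\<in>f. \<forall>V\<in>f. U \<subseteq> V \<or> V \<subseteq> U) \<and> vec.dim ` f = J}"

text \<open>The number of ways to extend an adapted list of length \<open>j\<close> by one vector. The new vector lies in the
smallest member of dimension \<open>> j\<close> of the flag, of type \<open>J\<close>, if there is one, and is otherwise an
arbitrary singular vector orthogonal to the list; vectors in the span of the list are excluded.\<close>

definition extension_count :: "nat set \<Rightarrow> nat \<Rightarrow> real" where
  "extension_count J j = (if \<exists>b\<in>J. j < b then real CARD('a) ^ (LEAST b. b \<in> J \<and> j < b) else sing_perp_count j)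
     - real CARD('a) ^ j"

lemma finite_gen_bases [simp]: "finite gen_bases"
  using finite_lists_length_eq[of "UNIV :: ('a ^ 'd) set" n] by (auto simp: gen_bases_def elim: finite_subset[rotated])

lemma sing_basis_Nil: "sing_basis []"
  by (simp add: sing_basis_def tot_sing_zero)

lemma sing_basis_snoc:
  "sing_basis (ws @ [x]) \<longleftrightarrow>
     sing_basis ws \<and> S x \<and> x \<in> perp (vec.span (set ws)) \<and> x \<notin> vec.span (set ws)"
proof
  assume h: "sing_basis (ws @ [x])"
  have "vec.span (set ws) \<subseteq> vec.span (insert x (set ws))"
    by (intro vec.span_mono) auto
  then have 1: "tot_sing (vec.span (set ws))"
    using h tot_sing_subset[OF _ vec.subspace_span] by (auto simp: sing_basis_def)
  have 2: "S x" "x \<in> perp (vec.span (set ws))"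
  proof -
    have ts: "tot_sing (vec.span (insert x (set ws)))"
      using h by (simp add: sing_basis_def)
    have x: "x \<in> vec.span (insert x (set ws))"
      by (simp add: vec.span_base)
    show "S x" using tot_singD(2)[OF ts x] .
    show "x \<in> perp (vec.span (set ws))"
      using tot_singD(3)[OF ts] x perp_antimono[of "set ws" "insert x (set ws)"]
      unfolding perp_span by blast
  qed
  have "vec.dim (set ws) \<le> length ws"
    using vec.dim_le_card[OF vec.span_superset, of "set ws"] card_length[of ws] by simp
  then have "x \<notin> vec.span (set ws)" "vec.dim (set ws) = length ws"
    using h by (auto simp: sing_basis_def vec.dim_insert split: if_splits)
  then show "sing_basis ws \<and> S x \<and> x \<in> perp (vec.span (set ws)) \<and> x \<notin> vec.span (set ws)"
    using 1 2 by (simp add: sing_basis_def)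
next
  assume h: "sing_basis ws \<and> S x \<and> x \<in> perp (vec.span (set ws)) \<and> x \<notin> vec.span (set ws)"
  then have "tot_sing (vec.span (insert x (vec.span (set ws))))"
    by (intro tot_sing_insert) (auto simp: sing_basis_def)
  moreover have "vec.span (insert x (vec.span (set ws))) = vec.span (insert x (set ws))"
    by (simp add: vec.span_insert vec.span_span)
  ultimately show "sing_basis (ws @ [x])"
    using h by (simp add: sing_basis_def vec.dim_insert)
qed

lemma sing_basis_append: "sing_basis (ws @ us) \<Longrightarrow> sing_basis ws"
  by (induction us rule: rev_induct) (auto simp: sing_basis_snoc simp flip: append_assoc)

lemma sing_basis_take: "sing_basis ws \<Longrightarrow> sing_basis (take k ws)"
  by (metis append_take_drop_id sing_basis_append)

lemma sing_basisD:
  assumes "sing_basis ws" "i \<le> length ws"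
  shows "tot_sing (vec.span (set (take i ws)))" "vec.dim (vec.span (set (take i ws))) = i"
  using sing_basis_take[OF assms(1), of i] assms(2) by (auto simp: sing_basis_def)

lemma card_adapted_steps:
  assumes f: "f \<in> typed_flags J" and ws: "sing_basis ws" "adapted f ws"
  shows "real (card {x. sing_basis (ws @ [x]) \<and> adapted f (ws @ [x])}) = extension_count J (length ws)"
proof -
  let ?j = "length ws" and ?W = "vec.span (set ws)"
  let ?X = "{x. sing_basis (ws @ [x]) \<and> adapted f (ws @ [x])}"
  have W: "tot_sing ?W" "vec.dim ?W = ?j" and card_W: "card ?W = CARD('a) ^ ?j"
    using ws by (auto simp: sing_basis_def card_subspace)
  have X: "?X = {x. S x \<and> x \<in> perp ?W \<and> (\<forall>U\<in>f. ?j < vec.dim U \<longrightarrow> x \<in> U)} - ?W"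
    using ws by (auto simp: sing_basis_snoc adapted_snoc)
  show ?thesis
  proof (cases "\<exists>b\<in>J. ?j < b")
    case True
    define b where "b = (LEAST b. b \<in> J \<and> ?j < b)"
    have b: "b \<in> J" "?j < b" and b_min: "\<And>c. c \<in> J \<Longrightarrow> ?j < c \<Longrightarrow> b \<le> c"
      using LeastI_ex[of "\<lambda>b. b \<in> J \<and> ?j < b"] True Least_le[of "\<lambda>b. b \<in> J \<and> ?j < b"]
      unfolding b_def by auto
    obtain U where U: "U \<in> f" "vec.dim U = b" and Us: "tot_sing U"
      using b f by (auto simp: typed_flags_def)
    have "set (take b ws) \<subseteq> U"
      using ws(2) U by (auto simp: adapted_def)
    then have "?W \<subseteq> U"
      using b Us by (intro vec.span_minimal) (auto simp: tot_singD)
    have "V \<supseteq> U" if "V \<in> f" "?j < vec.dim V" for V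
    proof -
      have V: "tot_sing V" "V \<subseteq> U \<or> U \<subseteq> V" "b \<le> vec.dim V"
        using that f U b_min by (auto simp: typed_flags_def)
      then show ?thesis
        using vec.subspace_dim_equal[of V U] U Us by (auto simp: tot_singD)
    qed
    then have "?X = U - ?W"
      unfolding X using U b tot_singD(2,3)[OF Us] perp_antimono[OF \<open>?W \<subseteq> U\<close>] by blast
    then have "real (card ?X) = real (card U) - real (card ?W)"
      using \<open>?W \<subseteq> U\<close> by (simp add: card_Diff_subset of_nat_diff card_mono)
    then show ?thesis
      using True U Us card_W by (simp add: extension_count_def b_def card_subspace tot_singD)
  next
    case False
    then have "?X = {x \<in> perp ?W. S x} - ?W"
      unfolding X using f by (auto simp: typed_flags_def)
    moreover have "?W \<subseteq> {x \<in> perp ?W. S x}"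
      using tot_singD(2,3)[OF W(1)] by auto
    ultimately have "real (card ?X) = real (card {x \<in> perp ?W. S x}) - real (card ?W)"
      by (simp add: card_Diff_subset of_nat_diff card_mono)
    then show ?thesis
      using False card_W W(2) by (simp add: extension_count_def card_singular_perp[OF W(1)] del: vec.dim_span)
  qed
qed

lemma extension_count_pos:
  assumes "j < n"
  shows "0 < extension_count J j"
proof (cases "\<exists>b\<in>J. j < b")
  case True
  then have "j < (LEAST b. b \<in> J \<and> j < b)"
    using LeastI_ex[of "\<lambda>b. b \<in> J \<and> j < b"] by auto
  then show ?thesis
    using True card_field_gt_1 by (simp add: extension_count_def power_strict_increasing)
next
  case False
  have "real CARD('a) ^ (CARD('d) - n) \<le> real CARD('a) ^ (CARD('d) - j)"
    using assms card_field_gt_1 by (intro power_increasing) auto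
  then have "0 \<le> \<theta> * (real CARD('a) ^ (CARD('d) - j) - real CARD('a) ^ (CARD('d) - n))"
    using theta_nonneg by simp
  moreover have "real CARD('a) ^ j < real CARD('a) ^ n"
    using assms card_field_gt_1 by (intro power_strict_increasing) auto
  ultimately show ?thesis
    using False by (simp add: extension_count_def sing_perp_count_def)
qed

text \<open>Extend the list by one vector at a time; the number of choices depends only on the length and on the
type of the flag.\<close>

lemma card_adapted_extensions:
  assumes f: "f \<in> typed_flags J"
  shows "sing_basis ws \<Longrightarrow> adapted f ws \<Longrightarrow> length ws \<le> n \<Longrightarrow>
    real (card {us \<in> gen_bases. adapted f us \<and> take (length ws) us = ws}) =
      (\<Prod>j=length ws..<n. extension_count J j)"
proof (induction "n - length ws" arbitrary: ws)
  case 0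
  then have "{us \<in> gen_bases. adapted f us \<and> take (length ws) us = ws} = {ws}"
    unfolding gen_bases_def by auto
  then show ?case using 0 by simp
next
  case (Suc m)
  let ?j = "length ws"
  let ?E = "\<lambda>vs. {us \<in> gen_bases. adapted f us \<and> take (length vs) us = vs}"
  let ?X = "{x. sing_basis (ws @ [x]) \<and> adapted f (ws @ [x])}"
  have j: "?j < n" using Suc.hyps(2) by simp
  have step: "take (Suc ?j) us = take ?j us @ [us ! ?j]" if "us \<in> gen_bases" for us
    using that j by (simp add: gen_bases_def take_Suc_conv_app_nth)
  have nth: "us ! ?j \<in> ?X" if "us \<in> ?E ws" for us
    using that step[of us] sing_basis_take[of us "Suc ?j"] adapted_take[of f us "Suc ?j"]
    by (simp add: gen_bases_def)
  have fibre: "{us \<in> ?E ws. us ! ?j = x} = ?E (ws @ [x])" for x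
    using step by auto
  have "card (?E ws) = (\<Sum>x\<in>?X. card {us \<in> ?E ws. us ! ?j = x})"
    using nth by (intro card_as_sum_of_fibres) auto
  also have "\<dots> = (\<Sum>x\<in>?X. card (?E (ws @ [x])))"
    by (simp only: fibre)
  finally have "real (card (?E ws)) = (\<Sum>x\<in>?X. real (card (?E (ws @ [x]))))"
    by simp
  also have "\<dots> = (\<Sum>x\<in>?X. \<Prod>j=Suc ?j..<n. extension_count J j)"
  proof (intro sum.cong refl)
    fix x assume x: "x \<in> ?X"
    show "real (card (?E (ws @ [x]))) = (\<Prod>j=Suc ?j..<n. extension_count J j)"
      using Suc.hyps(1)[of "ws @ [x]"] Suc.hyps(2) x j by simp
  qed
  also have "\<dots> = extension_count J ?j * (\<Prod>j=Suc ?j..<n. extension_count J j)"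
    by (simp only: sum_constant card_adapted_steps[OF f Suc.prems(1,2)])
  also have "\<dots> = (\<Prod>j=?j..<n. extension_count J j)"
    using j by (simp add: prod.atLeast_Suc_lessThan)
  finally show ?case .
qed

definition gen_bases_per_flag :: "nat set \<Rightarrow> real" where
  "gen_bases_per_flag J = (\<Prod>j<n. extension_count J j)"

lemma gen_bases_per_flag_pos: "0 < gen_bases_per_flag J"
  by (auto simp: gen_bases_per_flag_def intro!: prod_pos extension_count_pos)

lemma card_adapted:
  assumes "f \<in> typed_flags J"
  shows "real (card {us \<in> gen_bases. adapted f us}) = gen_bases_per_flag J"
  using card_adapted_extensions[OF assms sing_basis_Nil]
  by (simp add: adapted_def gen_bases_per_flag_def lessThan_atLeast0)

lemma flag_of_in_typed_flags:
  assumes "us \<in> gen_bases" "J \<subseteq> {1..n}"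
  shows "flag_of J us \<in> typed_flags J"
proof -
  have us: "sing_basis us" "length us = n" using assms by (auto simp: gen_bases_def)
  have D: "tot_sing (vec.span (set (take i us)))" "vec.dim (vec.span (set (take i us))) = i" if "i \<in> J" for i
    using sing_basisD[OF us(1), of i] us(2) assms(2) that by auto
  have "vec.span (set (take i us)) \<subseteq> vec.span (set (take j us))" if "i \<le> j" for i j
    using that by (intro vec.span_mono set_take_subset_set_take)
  then have "vec.span (set (take i us)) \<subseteq> vec.span (set (take j us)) \<or>
      vec.span (set (take j us)) \<subseteq> vec.span (set (take i us))" for i j
    using linear[of i j] by blast
  then have "\<forall>U\<in>flag_of J us. \<forall>V\<in>flag_of J us. U \<subseteq> V \<or> V \<subseteq> U"
    unfolding flag_of_def by blast
  moreover have "vec.dim ` flag_of J us = (\<lambda>i. i) ` J"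
    unfolding flag_of_def image_image by (intro image_cong refl D)
  moreover have "\<forall>U\<in>flag_of J us. tot_sing U"
    using D(1) by (simp add: flag_of_def)
  ultimately show ?thesis
    unfolding typed_flags_def by simp
qed

lemma flag_of_eq_iff:
  assumes "us \<in> gen_bases" "f \<in> typed_flags J" "J \<subseteq> {1..n}"
  shows "flag_of J us = f \<longleftrightarrow> adapted f us"
proof -
  have us: "sing_basis us" "length us = n" using assms by (auto simp: gen_bases_def)
  note D = sing_basisD[OF us(1), unfolded us(2)]
  have dim: "vec.dim ` f = J" using assms by (simp add: typed_flags_def)
  show ?thesis
  proof
    assume eq: "flag_of J us = f"
    show "adapted f us"
      unfolding adapted_def
    proof
      fix U assume "U \<in> f"
      then obtain i where i: "i \<in> J" "U = vec.span (set (take i us))"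
        unfolding eq[symmetric] flag_of_def by blast
      then have "vec.dim U = i" using D(2)[of i] assms(3) by auto
      then show "set (take (vec.dim U) us) \<subseteq> U"
        using i vec.span_superset by simp
    qed
  next
    assume ad: "adapted f us"
    have "vec.span (set (take (vec.dim U) us)) = U" if "U \<in> f" for U
    proof -
      have U: "tot_sing U" "vec.dim U \<le> n"
        using that assms(2,3) by (auto simp: typed_flags_def)
      have "vec.span (set (take (vec.dim U) us)) \<subseteq> U"
        using ad that U by (intro vec.span_minimal) (auto simp: adapted_def tot_singD)
      then show ?thesis
        using D(2)[OF U(2)] U by (intro vec.subspace_dim_equal) (auto simp: tot_singD)
    qed
    then have "(\<lambda>U. vec.span (set (take (vec.dim U) us))) ` f = f" by simp
    then show "flag_of J us = f" unfolding flag_of_def dim[symmetric] image_image .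
  qed
qed

text \<open>Each ordered basis of a generator is adapted to exactly one flag of type \<open>J\<close>, and each flag of type \<open>J\<close>
has the same number of adapted bases. So flags may be counted by their adapted bases.\<close>

lemma card_flags_times:
  assumes J: "J \<subseteq> {1..n}"
  shows "real (card {f \<in> typed_flags J. R f}) * gen_bases_per_flag J = real (card {us \<in> gen_bases. R (flag_of J us)})"
proof -
  let ?L = "{us \<in> gen_bases. R (flag_of J us)}" and ?F = "{f \<in> typed_flags J. R f}"
  have "card ?L = (\<Sum>f\<in>?F. card {us \<in> ?L. flag_of J us = f})"
    using flag_of_in_typed_flags[OF _ J] by (intro card_as_sum_of_fibres) auto
  also have "\<dots> = (\<Sum>f\<in>?F. card {us \<in> gen_bases. adapted f us})"
  proof (intro sum.cong refl arg_cong[where f = card])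
    fix f assume "f \<in> ?F"
    then show "{us \<in> ?L. flag_of J us = f} = {us \<in> gen_bases. adapted f us}"
      using flag_of_eq_iff[OF _ _ J, of _ f] by auto
  qed
  finally have "real (card ?L) = (\<Sum>f\<in>?F. real (card {us \<in> gen_bases. adapted f us}))"
    by simp
  also have "\<dots> = (\<Sum>f\<in>?F. gen_bases_per_flag J)"
    by (intro sum.cong refl card_adapted) auto
  also have "\<dots> = real (card ?F) * gen_bases_per_flag J"
    by simp
  finally show ?thesis by simp
qed

end

section \<open>Flags at a generator or at a point\<close>

context singular_geometry_of_rank
begin

text \<open>The case \<open>U = 0\<close> of \<open>card_singular_perp\<close>. In the classical polar spaces \<open>\<theta> q ^ (d - n)\<close> is
\<open>q powr (n + e - 1)\<close>, where \<open>d\<close> is the dimension of the ambient space.\<close>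

lemma card_singular_vectors:
  "real (card {v. S v \<and> v \<noteq> 0}) = (real CARD('a) ^ n - 1) * (1 + \<theta> * real CARD('a) ^ (CARD('d) - n))"
proof -
  have "perp {0} = UNIV"
    using orthogonal_sym by (fastforce simp: perp_def)
  then have "real (card {v. S v}) = sing_perp_count 0"
    using card_singular_perp[OF tot_sing_zero] by simp
  moreover have "{v. S v \<and> v \<noteq> 0} = {v. S v} - {0}"
    by auto
  then have "real (card {v. S v \<and> v \<noteq> 0}) = real (card {v. S v}) - 1"
    using card.remove[of "{v. S v}" 0] S_zero by simp
  moreover have "real CARD('a) ^ CARD('d) = real CARD('a) ^ n * real CARD('a) ^ (CARD('d) - n)"
    using rank_le_dim by (simp flip: power_add)
  ultimately show ?thesis
    by (simp add: sing_perp_count_def algebra_simps)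
qed

lemma gen_bases_span:
  assumes "us \<in> gen_bases"
  shows "vec.span (set us) \<in> gens"
  using assms by (simp add: gen_bases_def sing_basis_def gens_def)

lemma gen_bases_hd:
  assumes "us \<in> gen_bases" "1 \<le> n"
  shows "take 1 us = [us ! 0]" "S (us ! 0)" "us ! 0 \<noteq> 0"
proof -
  have us: "sing_basis us" "length us = n" using assms by (auto simp: gen_bases_def)
  then show *: "take 1 us = [us ! 0]" using assms(2) by (cases us) auto
  then have "sing_basis ([] @ [us ! 0])" using sing_basis_take[OF us(1), of 1] by simp
  then show "S (us ! 0)" "us ! 0 \<noteq> 0" unfolding sing_basis_snoc by auto
qed

text \<open>The continuation of a list of length 1 to a basis of a generator is subject to no flag, so the empty
flag makes \<open>card_adapted_extensions\<close> applicable: every nonzero singular vector is the first vector of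
equally many bases.\<close>

lemma card_gen_bases_hd:
  assumes A: "A \<subseteq> {v. S v \<and> v \<noteq> 0}" and n: "1 \<le> n"
  shows "real (card {us \<in> gen_bases. us ! 0 \<in> A}) = card A * (\<Prod>j=1..<n. extension_count {} j)"
proof -
  have fibre: "real (card {us \<in> {us \<in> gen_bases. us ! 0 \<in> A}. us ! 0 = x}) = (\<Prod>j=1..<n. extension_count {} j)"
    if "x \<in> A" for x
  proof -
    \<comment> \<open>written as an extension of the empty list, to which \<open>sing_basis_snoc\<close> applies\<close>
    have "sing_basis ([] @ [x])"
      unfolding sing_basis_snoc using sing_basis_Nil that A orthogonal_sym
      by (force simp: perp_def)
    moreover have "{} \<in> typed_flags {}" by (simp add: typed_flags_def)
    ultimately have "real (card {us \<in> gen_bases. adapted {} us \<and> take 1 us = [x]}) = (\<Prod>j=1..<n. extension_count {} j)"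
      using card_adapted_extensions[of "{}" "{}" "[x]"] n by (simp add: adapted_def)
    moreover have "{us \<in> {us \<in> gen_bases. us ! 0 \<in> A}. us ! 0 = x} = {us \<in> gen_bases. adapted {} us \<and> take 1 us = [x]}"
      using gen_bases_hd(1)[OF _ n] that by (auto simp: adapted_def simp del: One_nat_def)
    ultimately show ?thesis by (simp only:)
  qed
  have "card {us \<in> gen_bases. us ! 0 \<in> A} = (\<Sum>x\<in>A. card {us \<in> {us \<in> gen_bases. us ! 0 \<in> A}. us ! 0 = x})"
    by (intro card_as_sum_of_fibres) auto
  then have "real (card {us \<in> gen_bases. us ! 0 \<in> A}) =
      (\<Sum>x\<in>A. real (card {us \<in> {us \<in> gen_bases. us ! 0 \<in> A}. us ! 0 = x}))"
    by (simp only: of_nat_sum)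
  also have "\<dots> = (\<Sum>x\<in>A. \<Prod>j=1..<n. extension_count {} j)"
    by (intro sum.cong refl fibre)
  finally show ?thesis by simp
qed

text \<open>The point of the flag of a basis is spanned by its first vector, so the proportion of flags equals the
proportion \<open>(q\<^sup>n - 1) / ((q\<^sup>n - 1) (1 + \<theta> q ^ (d - n)))\<close> of nonzero singular vectors that lie in \<open>N\<close>.\<close>

theorem card_flags_point_in_generator:
  assumes J: "J \<subseteq> {1..n}" "1 \<in> J" and N: "N \<in> gens"
  shows "real (card {f \<in> typed_flags J. \<exists>P\<in>f. vec.dim P = 1 \<and> P \<subseteq> N}) *
      (1 + \<theta> * real CARD('a) ^ (CARD('d) - n)) = real (card (typed_flags J))"
proof -
  have n: "1 \<le> n" using J by auto
  let ?R = "\<lambda>f. \<exists>P\<in>f. vec.dim P = 1 \<and> P \<subseteq> N"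
  let ?z = "\<Prod>j=1..<n. extension_count {} j"
  have R: "?R (flag_of J us) \<longleftrightarrow> us ! 0 \<in> N - {0}" if us: "us \<in> gen_bases" for us
  proof -
    have us': "sing_basis us" "length us = n" using us by (auto simp: gen_bases_def)
    have "?R (flag_of J us) \<longleftrightarrow> vec.span (set (take 1 us)) \<subseteq> N"
    proof
      assume "?R (flag_of J us)"
      then obtain i where i: "i \<in> J" "vec.dim (vec.span (set (take i us))) = 1"
        "vec.span (set (take i us)) \<subseteq> N"
        unfolding flag_of_def by blast
      moreover have "vec.dim (vec.span (set (take i us))) = i"
        using i J us' by (intro sing_basisD) auto
      ultimately show "vec.span (set (take 1 us)) \<subseteq> N" by simp
    next
      assume "vec.span (set (take 1 us)) \<subseteq> N"
      moreover have "vec.dim (vec.span (set (take 1 us))) = 1"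
        using us' n by (intro sing_basisD) auto
      ultimately show "?R (flag_of J us)"
        unfolding flag_of_def using J by blast
    qed
    also have "\<dots> \<longleftrightarrow> us ! 0 \<in> N"
      using gen_bases_hd(1)[OF us n] vec.span_minimal[OF _ gensD(3)[OF N], of "{us ! 0}"]
        vec.span_superset[of "{us ! 0}"] by auto
    finally show ?thesis using gen_bases_hd(3)[OF us n] by simp
  qed
  have "{us \<in> gen_bases. ?R (flag_of J us)} = {us \<in> gen_bases. us ! 0 \<in> N - {0}}"
    using R by blast
  then have "real (card {f \<in> typed_flags J. ?R f}) * gen_bases_per_flag J = real (card {us \<in> gen_bases. us ! 0 \<in> N - {0}})"
    using card_flags_times[OF J(1), of ?R] by (simp only:)
  also have "\<dots> = real (card (N - {0})) * ?z"
    using tot_singD(2)[OF gensD(1)[OF N]] n by (intro card_gen_bases_hd) auto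
  also have "real (card (N - {0})) = real CARD('a) ^ n - 1"
    using gensD[OF N] vec.subspace_0[OF gensD(3)[OF N]] by (simp add: of_nat_diff)
  finally have C: "real (card {f \<in> typed_flags J. ?R f}) * gen_bases_per_flag J = (real CARD('a) ^ n - 1) * ?z" .
  have "{us \<in> gen_bases. True} = {us \<in> gen_bases. us ! 0 \<in> {v. S v \<and> v \<noteq> 0}}"
    using gen_bases_hd(2,3)[OF _ n] by blast
  then have "real (card {f \<in> typed_flags J. True}) * gen_bases_per_flag J =
      real (card {us \<in> gen_bases. us ! 0 \<in> {v. S v \<and> v \<noteq> 0}})"
    using card_flags_times[OF J(1), of "\<lambda>_. True"] by (simp only:)
  also have "\<dots> = real (card {v. S v \<and> v \<noteq> 0}) * ?z"
    using n by (intro card_gen_bases_hd) auto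
  finally have v: "real (card (typed_flags J)) * gen_bases_per_flag J = real (card {v. S v \<and> v \<noteq> 0}) * ?z"
    by simp
  have "real (card {f \<in> typed_flags J. ?R f}) * (1 + \<theta> * real CARD('a) ^ (CARD('d) - n)) * gen_bases_per_flag J =
      real (card (typed_flags J)) * gen_bases_per_flag J"
    unfolding v card_singular_vectors using arg_cong[OF C, of "\<lambda>t. t * (1 + \<theta> * real CARD('a) ^ (CARD('d) - n))"]
    by (simp only: ac_simps)
  then show ?thesis using gen_bases_per_flag_pos[of J] by simp
qed

lemma adapted_gen_iff:
  assumes us: "us \<in> gen_bases" and G: "G \<in> gens"
  shows "adapted {G} us \<longleftrightarrow> vec.span (set us) = G"
proof -
  have "length us = n" using us by (simp add: gen_bases_def)
  then have "adapted {G} us \<longleftrightarrow> vec.span (set us) \<subseteq> G"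
    using gensD[OF G] vec.span_minimal[of "set us" G] vec.span_superset[of "set us"]
    by (auto simp: adapted_def)
  then show ?thesis
    using vec.subspace_dim_equal[of "vec.span (set us)" G] gensD[OF G] gensD[OF gen_bases_span[OF us]] by auto
qed

lemma card_gen_bases_span_in:
  assumes X: "X \<subseteq> gens"
  shows "real (card {us \<in> gen_bases. vec.span (set us) \<in> X}) = card X * gen_bases_per_flag {n}"
proof -
  let ?L = "{us \<in> gen_bases. vec.span (set us) \<in> X}"
  have fibre: "real (card {us \<in> ?L. vec.span (set us) = G}) = gen_bases_per_flag {n}" if "G \<in> X" for G
  proof -
    have "{us \<in> ?L. vec.span (set us) = G} = {us \<in> gen_bases. adapted {G} us}"
      using adapted_gen_iff[of _ G] X that by auto
    moreover have "{G} \<in> typed_flags {n}"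
      using X that by (auto simp: typed_flags_def gens_def)
    ultimately show ?thesis by (simp only: card_adapted)
  qed
  have "card ?L = (\<Sum>G\<in>X. card {us \<in> ?L. vec.span (set us) = G})"
    by (intro card_as_sum_of_fibres) auto
  then have "real (card ?L) = (\<Sum>G\<in>X. real (card {us \<in> ?L. vec.span (set us) = G}))"
    by (simp only: of_nat_sum)
  also have "\<dots> = (\<Sum>G\<in>X. gen_bases_per_flag {n})"
    by (intro sum.cong refl fibre)
  finally show ?thesis by simp
qed

text \<open>All generators are members of the same number of flags of type \<open>J\<close>; this is \<open>card_flags_times\<close> for
\<open>J\<close>, where the property of the flag is read off from the span of the basis.\<close>

lemma card_flags_generator_in:
  assumes J: "J \<subseteq> {1..n}" "n \<in> J" and X: "X \<subseteq> gens"
  shows "real (card {f \<in> typed_flags J. \<exists>N\<in>f. vec.dim N = n \<and> N \<in> X}) * card gens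
    = real (card X) * card (typed_flags J)"
proof -
  let ?R = "\<lambda>Y f. \<exists>N\<in>f. vec.dim N = n \<and> N \<in> Y"
  have R: "?R Y (flag_of J us) \<longleftrightarrow> vec.span (set us) \<in> Y" if us: "us \<in> gen_bases" for us Y
  proof -
    have us': "sing_basis us" "length us = n" using us by (auto simp: gen_bases_def)
    have dim: "vec.dim (vec.span (set (take i us))) = i" if "i \<in> J" for i
      using that J us' by (intro sing_basisD) auto
    have "?R Y (flag_of J us) \<longleftrightarrow> (\<exists>i\<in>J. vec.dim (vec.span (set (take i us))) = n \<and> vec.span (set (take i us)) \<in> Y)"
      unfolding flag_of_def by blast
    also have "\<dots> \<longleftrightarrow> vec.span (set (take n us)) \<in> Y"
      using dim J(2) by (simp del: vec.dim_span)
    finally show ?thesis using us' by simp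
  qed
  have count: "real (card {f \<in> typed_flags J. ?R Y f}) * gen_bases_per_flag J = card Y * gen_bases_per_flag {n}"
    if Y: "Y \<subseteq> gens" for Y
  proof -
    have "{us \<in> gen_bases. ?R Y (flag_of J us)} = {us \<in> gen_bases. vec.span (set us) \<in> Y}"
      using R by blast
    then show ?thesis
      using card_flags_times[OF J(1), of "?R Y"] card_gen_bases_span_in[OF Y] by (simp only:)
  qed
  have "{f \<in> typed_flags J. ?R gens f} = typed_flags J"
  proof -
    have "?R gens f" if f: "f \<in> typed_flags J" for f
    proof -
      have "n \<in> vec.dim ` f" using f J by (simp add: typed_flags_def)
      then show ?thesis using f by (auto simp: typed_flags_def gens_def)
    qed
    then show ?thesis by blast
  qed
  then have v: "real (card (typed_flags J)) * gen_bases_per_flag J = card gens * gen_bases_per_flag {n}"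
    using count[OF order_refl] by simp
  have "(real (card {f \<in> typed_flags J. ?R X f}) * card gens) * (gen_bases_per_flag J * gen_bases_per_flag {n}) =
      (real (card X) * card (typed_flags J)) * (gen_bases_per_flag J * gen_bases_per_flag {n})"
  proof -
    have "(real (card {f \<in> typed_flags J. ?R X f}) * card gens) * (gen_bases_per_flag J * gen_bases_per_flag {n}) =
       (real (card {f \<in> typed_flags J. ?R X f}) * gen_bases_per_flag J) * (card gens * gen_bases_per_flag {n})"
      by simp
    also have "\<dots> = (card X * gen_bases_per_flag {n}) * (real (card (typed_flags J)) * gen_bases_per_flag J)"
      by (simp only: count[OF X] v)
    finally show ?thesis by simp
  qed
  then show ?thesis
    using gen_bases_per_flag_pos[of J] gen_bases_per_flag_pos[of "{n}"] by simp
qed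

text \<open>The bases adapted to \<open>{P}\<close> are distributed over the generators \<open>G\<close> through \<open>P\<close> according to their
span, and each \<open>G\<close> receives those adapted to \<open>{P, G}\<close>. The purpose of the formula is that its
right-hand side does not depend on \<open>P\<close>.\<close>

lemma card_gens_through_point:
  assumes P: "tot_sing P" "vec.dim P = 1" and n: "1 \<le> n"
  shows "real (card {G \<in> gens. P \<subseteq> G}) = gen_bases_per_flag {1} / gen_bases_per_flag {1, n}"
proof -
  let ?L = "{us \<in> gen_bases. adapted {P} us}" and ?G = "{G \<in> gens. P \<subseteq> G}"
  have flag: "{P} \<in> typed_flags {1}" using P by (simp add: typed_flags_def)
  have sub: "P \<subseteq> vec.span (set us)" if "us \<in> ?L" for us
  proof -
    have "flag_of {1} us = {P}"
      using flag_of_eq_iff[OF _ flag] that n by simp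
    then have "P = vec.span (set (take 1 us))" by (simp add: flag_of_def)
    also have "\<dots> \<subseteq> vec.span (set us)" by (intro vec.span_mono set_take_subset)
    finally show ?thesis .
  qed
  have fibre: "real (card {us \<in> ?L. vec.span (set us) = G}) = gen_bases_per_flag {1, n}" if G: "G \<in> ?G" for G
  proof -
    have "{us \<in> ?L. vec.span (set us) = G} = {us \<in> gen_bases. adapted {P, G} us}"
      using adapted_gen_iff[of _ G] G by (auto simp: adapted_def)
    moreover have "{P, G} \<in> typed_flags {1, n}"
      using P G by (auto simp: typed_flags_def gens_def)
    ultimately show ?thesis by (simp only: card_adapted)
  qed
  have "card ?L = (\<Sum>G\<in>?G. card {us \<in> ?L. vec.span (set us) = G})"
    using sub gen_bases_span by (intro card_as_sum_of_fibres) auto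
  then have "real (card ?L) = (\<Sum>G\<in>?G. real (card {us \<in> ?L. vec.span (set us) = G}))"
    by (simp only: of_nat_sum)
  also have "\<dots> = (\<Sum>G\<in>?G. gen_bases_per_flag {1, n})"
    by (intro sum.cong refl fibre)
  finally have "gen_bases_per_flag {1} = real (card ?G) * gen_bases_per_flag {1, n}"
    by (simp add: card_adapted[OF flag])
  then show ?thesis using gen_bases_per_flag_pos[of "{1, n}"] by simp
qed

text \<open>Count the pairs of a nonzero singular vector and a generator that contains it.\<close>

lemma card_gens_through_point_ratio:
  assumes P: "tot_sing P" "vec.dim P = 1" and n: "1 \<le> n"
  shows "real (card {G \<in> gens. P \<subseteq> G}) * (1 + \<theta> * real CARD('a) ^ (CARD('d) - n)) = card gens"
proof -
  let ?V = "{v. S v \<and> v \<noteq> 0}"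
  let ?g = "real (card {G \<in> gens. P \<subseteq> G})"
  have point: "real (card {G \<in> gens. v \<in> G}) = ?g" if v: "v \<in> ?V" for v
  proof -
    have ts: "tot_sing (vec.span {v})"
      using tot_sing_insert[OF tot_sing_zero, of v] v orthogonal_sym
      by (force simp: perp_def insert_commute)
    have dim: "vec.dim (vec.span {v}) = 1" using v by simp
    have "real (card {G \<in> gens. vec.span {v} \<subseteq> G}) = ?g"
      by (simp only: card_gens_through_point[OF ts dim n] card_gens_through_point[OF P n])
    moreover have "{G \<in> gens. vec.span {v} \<subseteq> G} = {G \<in> gens. v \<in> G}"
      using vec.span_minimal[of "{v}"] vec.span_base[of v "{v}"] gensD(3) by blast
    ultimately show ?thesis by simp
  qed
  have gen: "real (card {v \<in> ?V. v \<in> G}) = real CARD('a) ^ n - 1" if G: "G \<in> gens" for G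
  proof -
    have "{v \<in> ?V. v \<in> G} = G - {0}"
      using tot_singD(2)[OF gensD(1)[OF G]] by auto
    then show ?thesis
      using gensD[OF G] vec.subspace_0[OF gensD(3)[OF G]] by (simp add: of_nat_diff)
  qed
  have "(\<Sum>v\<in>?V. card {G \<in> gens. v \<in> G}) = (\<Sum>G\<in>gens. card {v \<in> ?V. v \<in> G})"
    by (rule sum_multicount_gen) auto
  then have "(\<Sum>v\<in>?V. real (card {G \<in> gens. v \<in> G})) = (\<Sum>G\<in>gens. real (card {v \<in> ?V. v \<in> G}))"
    by (simp only: flip: of_nat_sum)
  moreover have "(\<Sum>v\<in>?V. real (card {G \<in> gens. v \<in> G})) = (\<Sum>v\<in>?V. ?g)"
    by (intro sum.cong refl point)
  moreover have "(\<Sum>G\<in>gens. real (card {v \<in> ?V. v \<in> G})) = (\<Sum>G\<in>gens. real CARD('a) ^ n - 1)"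
    by (intro sum.cong refl gen)
  ultimately have "real (card ?V) * ?g = card gens * (real CARD('a) ^ n - 1)"
    by simp
  then have "(real CARD('a) ^ n - 1) * (?g * (1 + \<theta> * real CARD('a) ^ (CARD('d) - n))) =
      (real CARD('a) ^ n - 1) * card gens"
    unfolding card_singular_vectors by (simp add: algebra_simps)
  moreover have "real CARD('a) ^ n > 1"
    using card_field_gt_1 n by (intro one_less_power) auto
  ultimately show ?thesis by simp
qed

lemma card_gens_pos: "0 < card gens"
  using ex_gen by (auto simp: card_gt_0_iff gens_def)

theorem card_flags_generator_through_point:
  assumes J: "J \<subseteq> {1..n}" "n \<in> J" and P: "tot_sing P" "vec.dim P = 1"
  shows "real (card {f \<in> typed_flags J. \<exists>N\<in>f. vec.dim N = n \<and> P \<subseteq> N}) *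
      (1 + \<theta> * real CARD('a) ^ (CARD('d) - n)) = real (card (typed_flags J))"
proof -
  let ?F = "{f \<in> typed_flags J. \<exists>N\<in>f. vec.dim N = n \<and> P \<subseteq> N}"
  have "?F = {f \<in> typed_flags J. \<exists>N\<in>f. vec.dim N = n \<and> N \<in> {G \<in> gens. P \<subseteq> G}}"
    by (auto simp: typed_flags_def gens_def)
  then have "real (card ?F) * card gens = real (card {G \<in> gens. P \<subseteq> G}) * card (typed_flags J)"
    using card_flags_generator_in[OF J, of "{G \<in> gens. P \<subseteq> G}"] by simp
  then have "real (card ?F) * (1 + \<theta> * real CARD('a) ^ (CARD('d) - n)) * card gens =
      real (card {G \<in> gens. P \<subseteq> G}) * (1 + \<theta> * real CARD('a) ^ (CARD('d) - n)) * card (typed_flags J)"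
    by (simp add: algebra_simps)
  also have "real (card {G \<in> gens. P \<subseteq> G}) * (1 + \<theta> * real CARD('a) ^ (CARD('d) - n)) = card gens"
    using J by (intro card_gens_through_point_ratio P) auto
  finally show ?thesis using card_gens_pos by auto
qed

end

section \<open>The two classes of generators\<close>

text \<open>The hyperbolic quadrics, where \<open>d = 2 n\<close> and \<open>\<theta> = 1 / q\<close>.\<close>

locale hyperbolic_geometry = singular_geometry_of_rank B S \<theta> n
  for B :: "'a::{field,finite} ^ 'd::finite \<Rightarrow> 'a ^ 'd \<Rightarrow> 'a" and S :: "'a ^ 'd \<Rightarrow> bool"
    and \<theta> :: real and n :: nat +
  assumes n_pos: "1 \<le> n"
    and d_eq: "CARD('d) = 2 * n"
    and theta_eq: "\<theta> * real CARD('a) = 1"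
begin

text \<open>There are \<open>2 (q\<^sup>n - q ^ (n - 1))\<close> singular vectors in \<open>H\<^sup>\<bottom> - H\<close>. Each of them spans with \<open>H\<close> a generator,
and each generator through \<open>H\<close> arises from \<open>q\<^sup>n - q ^ (n - 1)\<close> of them.\<close>

lemma card_gens_through_hyperplane:
  assumes H: "tot_sing H" "vec.dim H = n - 1"
  shows "card {G \<in> gens. H \<subseteq> G} = 2"
proof -
  let ?X = "{w \<in> perp H. S w} - H" and ?G = "{G \<in> gens. H \<subseteq> G}"
  let ?q = "real CARD('a)"
  have Hs: "vec.subspace H" and HH: "H \<subseteq> {w \<in> perp H. S w}"
    using tot_singD[OF H(1)] by auto
  have q: "?q ^ n = ?q * ?q ^ (n - 1)"
    using n_pos by (simp flip: power_Suc)
  have "CARD('d) - (n - 1) = Suc n" "CARD('d) - n = n" using d_eq n_pos by auto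
  then have "sing_perp_count (n - 1) = ?q ^ n + (\<theta> * ?q) * (?q ^ n - ?q ^ (n - 1))"
    by (simp add: sing_perp_count_def q algebra_simps)
  then have z: "sing_perp_count (n - 1) = 2 * ?q ^ n - ?q ^ (n - 1)"
    by (simp add: theta_eq)
  have "real (card ?X) = sing_perp_count (n - 1) - real (card H)"
    using HH card_singular_perp[OF H(1)] H(2) by (simp add: card_Diff_subset of_nat_diff card_mono)
  then have X: "real (card ?X) = 2 * (?q ^ n - ?q ^ (n - 1))"
    using H tot_singD(1)[OF H(1)] by (simp add: z card_subspace del: One_nat_def)
  have span: "vec.span (insert w H) \<in> ?G" if "w \<in> ?X" for w
    using that tot_sing_insert[OF H(1), of w] H(2) Hs n_pos vec.span_superset[of "insert w H"]
    by (auto simp: gens_def vec.dim_insert span_of_subspace)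
  have fibre: "real (card {w \<in> ?X. vec.span (insert w H) = G}) = ?q ^ n - ?q ^ (n - 1)"
    if G: "G \<in> ?G" for G
  proof -
    have "vec.span (insert w H) = G" if w: "w \<in> G - H" for w
    proof -
      have "vec.span (insert w H) \<subseteq> G"
        using w G gensD(3)[of G] by (intro vec.span_minimal) auto
      moreover have "vec.dim (vec.span (insert w H)) = n"
        using w H(2) Hs n_pos by (simp add: vec.dim_insert span_of_subspace)
      ultimately show ?thesis
        using gensD[of G] G by (intro vec.subspace_dim_equal) auto
    qed
    moreover have "G \<subseteq> {w \<in> perp H. S w}"
      using G tot_singD(2,3)[OF gensD(1)[of G]] perp_antimono[of H G] by blast
    moreover have "w \<in> vec.span (insert w H)" for w by (simp add: vec.span_base)
    ultimately have "{w \<in> ?X. vec.span (insert w H) = G} = G - H" by blast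
    moreover have "real (card (G - H)) = real (card G) - real (card H)"
      using G by (simp add: card_Diff_subset of_nat_diff card_mono)
    ultimately show ?thesis
      using G H(2) Hs gensD(4)[of G] by (simp add: card_subspace)
  qed
  have "card ?X = (\<Sum>G\<in>?G. card {w \<in> ?X. vec.span (insert w H) = G})"
    using span by (intro card_as_sum_of_fibres image_subsetI finite)
  then have "real (card ?X) = (\<Sum>G\<in>?G. real (card {w \<in> ?X. vec.span (insert w H) = G}))"
    by (simp only: of_nat_sum)
  also have "\<dots> = (\<Sum>G\<in>?G. ?q ^ n - ?q ^ (n - 1))"
    by (intro sum.cong refl fibre)
  finally have eq: "real (card ?G) * (?q ^ n - ?q ^ (n - 1)) = 2 * (?q ^ n - ?q ^ (n - 1))"
    using X by simp
  have "?q ^ (n - 1) < ?q ^ n"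
    using card_field_gt_1 n_pos by (intro power_strict_increasing) auto
  then have "?q ^ n - ?q ^ (n - 1) \<noteq> 0" by simp
  then have "real (card ?G) = 2" using eq unfolding mult_cancel_right by blast
  then show ?thesis by simp
qed

text \<open>Put \<open>H = N1 \<inter> N2\<close>. Each of \<open>dim (M \<inter> N1)\<close> and \<open>dim (M \<inter> N2)\<close> is \<open>dim (M \<inter> H)\<close> or one more. They
are not both larger: vectors \<open>x \<in> M \<inter> N1\<close> and \<open>y \<in> M \<inter> N2\<close> outside \<open>H\<close> are orthogonal, so that \<open>y\<close>
would be orthogonal to \<open>N1 = H + \<langle>x\<rangle>\<close> and belong to it. They are not both equal to \<open>dim (M \<inter> H)\<close>: the
generator \<open>H + (H\<^sup>\<bottom> \<inter> M)\<close> is \<open>N1\<close> or \<open>N2\<close>, because no other generator contains \<open>H\<close>, and it has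
vectors of \<open>M\<close> outside \<open>H\<close>.\<close>

lemma adjacent_gens_parity:
  assumes N1: "N1 \<in> gens" and N2: "N2 \<in> gens" and H: "vec.dim (N1 \<inter> N2) = n - 1" and M: "M \<in> gens"
  shows "odd (vec.dim (M \<inter> N1) + vec.dim (M \<inter> N2))"
proof -
  let ?H = "N1 \<inter> N2"
  have sub: "vec.subspace ?H" "vec.subspace M" "vec.subspace N1" "vec.subspace N2"
    using gensD(3) N1 N2 M vec.subspace_inter by auto
  have Hts: "tot_sing ?H"
    using tot_sing_subset[OF gensD(1)[OF N1] sub(1)] by simp
  have ne: "N1 \<noteq> N2" using H gensD(2)[OF N1] n_pos by auto
  have bounds: "vec.dim (M \<inter> ?H) \<le> vec.dim (M \<inter> N)" "vec.dim (M \<inter> N) \<le> Suc (vec.dim (M \<inter> ?H))"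
    if N: "N \<in> gens" "?H \<subseteq> N" for N
  proof -
    show "vec.dim (M \<inter> ?H) \<le> vec.dim (M \<inter> N)"
      using N by (intro vec.dim_subset) auto
    have "vec.dim {x + y |x y. x \<in> M \<inter> N \<and> y \<in> ?H} + vec.dim ((M \<inter> N) \<inter> ?H) = vec.dim (M \<inter> N) + (n - 1)"
      using vec.dim_sums_Int[of "M \<inter> N" ?H] sub gensD(3)[OF N(1)] H vec.subspace_inter by auto
    moreover have "(M \<inter> N) \<inter> ?H = M \<inter> ?H" using N by auto
    moreover have "vec.dim {x + y |x y. x \<in> M \<inter> N \<and> y \<in> ?H} \<le> vec.dim N"
      using N vec.subspace_add[OF gensD(3)[OF N(1)]] by (intro vec.dim_subset) auto
    ultimately show "vec.dim (M \<inter> N) \<le> Suc (vec.dim (M \<inter> ?H))"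
      using gensD(2)[OF N(1)] n_pos by simp
  qed
  have not_both_large: False
    if 1: "vec.dim (M \<inter> N1) \<noteq> vec.dim (M \<inter> ?H)" and 2: "vec.dim (M \<inter> N2) \<noteq> vec.dim (M \<inter> ?H)"
  proof -
    have "M \<inter> N1 \<noteq> M \<inter> ?H" using 1 by auto
    then obtain x where x: "x \<in> M" "x \<in> N1" "x \<notin> ?H" by blast
    have "M \<inter> N2 \<noteq> M \<inter> ?H" using 2 by auto
    then obtain y where y: "y \<in> M" "y \<in> N2" "y \<notin> ?H" by blast
    have "vec.dim (vec.span (insert x ?H)) = n"
      using x sub(1) H n_pos by (simp add: vec.dim_insert span_of_subspace)
    moreover have "vec.span (insert x ?H) \<subseteq> N1"
      using x sub by (intro vec.span_minimal) auto
    ultimately have N1_eq: "vec.span (insert x ?H) = N1"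
      using sub gensD(2)[OF N1] by (intro vec.subspace_dim_equal) auto
    have "y \<in> perp ?H"
      using tot_singD(3)[OF gensD(1)[OF N2]] y perp_antimono[of ?H N2] by auto
    moreover have "B y x = 0"
      using tot_singD(3)[OF gensD(1)[OF M]] x y by (auto simp: perp_def)
    ultimately have "y \<in> perp (insert x ?H)" by (simp add: perp_def)
    then have "y \<in> perp N1" using N1_eq perp_span by metis
    then have "y \<in> N1" using gens_maximal[OF N1] tot_singD(2)[OF gensD(1)[OF N2]] y by blast
    then show False using y by simp
  qed
  have not_both_small: False
    if 1: "vec.dim (M \<inter> N1) = vec.dim (M \<inter> ?H)" and 2: "vec.dim (M \<inter> N2) = vec.dim (M \<inter> ?H)"
  proof -
    have M1: "M \<inter> N1 = M \<inter> ?H" "M \<inter> N2 = M \<inter> ?H"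
      using vec.subspace_dim_equal[of "M \<inter> ?H" "M \<inter> N1"] vec.subspace_dim_equal[of "M \<inter> ?H" "M \<inter> N2"]
        1 2 sub vec.subspace_inter by auto
    let ?J = "{x + y |x y. x \<in> ?H \<and> y \<in> perp ?H \<inter> M}"
    have J: "?J \<in> gens" by (rule join_in_gens[OF Hts M])
    have "0 \<in> perp ?H \<inter> M" "0 \<in> ?H"
      using sub subspace_perp[of ?H] by (auto simp: vec.subspace_0)
    then have J_sup: "?H \<subseteq> ?J" "perp ?H \<inter> M \<subseteq> ?J"
      using subset_sums_left[of "perp ?H \<inter> M" ?H] subset_sums_right[of ?H "perp ?H \<inter> M"] by simp_all
    have "\<not> perp ?H \<inter> M \<subseteq> ?H"
    proof
      assume "perp ?H \<inter> M \<subseteq> ?H"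
      then have "?J \<subseteq> ?H" using vec.subspace_add[OF sub(1)] by blast
      then have "vec.dim ?J \<le> vec.dim ?H" by (rule vec.dim_subset)
      then show False using gensD(2)[OF J] H n_pos by simp
    qed
    then obtain y where y: "y \<in> perp ?H" "y \<in> M" "y \<notin> ?H" by blast
    have "{N1, N2} \<subseteq> {G \<in> gens. ?H \<subseteq> G}" using N1 N2 by auto
    moreover have "card {N1, N2} = card {G \<in> gens. ?H \<subseteq> G}"
      using card_gens_through_hyperplane[OF Hts H] ne by simp
    ultimately have two: "{N1, N2} = {G \<in> gens. ?H \<subseteq> G}"
      by (intro card_subset_eq) auto
    obtain N where N: "N \<in> gens" "?H \<subseteq> N" "perp ?H \<inter> M \<subseteq> N"
      using J J_sup by (rule that)
    then have "N \<in> {N1, N2}" unfolding two by simp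
    moreover have "y \<in> N" using N(3) y by blast
    ultimately have "y \<in> N1 \<or> y \<in> N2" by blast
    then show False using M1 y by blast
  qed
  have "vec.dim (M \<inter> N1) = Suc (vec.dim (M \<inter> N2)) \<or> vec.dim (M \<inter> N2) = Suc (vec.dim (M \<inter> N1))"
    using bounds[OF N1] bounds[OF N2] not_both_large not_both_small by fastforce
  then show ?thesis by auto
qed

text \<open>Take \<open>x \<in> N' - N\<close> and \<open>N'' = \<langle>x\<rangle> + (x\<^sup>\<bottom> \<inter> N)\<close>, which contains \<open>N \<inter> N'\<close> and \<open>x\<close>.\<close>

lemma ex_adjacent_gen_closer:
  assumes N: "N \<in> gens" and N': "N' \<in> gens" and ne: "N \<noteq> N'"
  obtains N'' where "N'' \<in> gens" "vec.dim (N \<inter> N'') = n - 1"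
    "vec.dim (N \<inter> N') < vec.dim (N'' \<inter> N')"
proof -
  have "\<not> N' \<subseteq> N"
    using ne vec.subspace_dim_equal[of N' N] gensD[OF N] gensD[OF N'] by auto
  then obtain x where x: "x \<in> N'" "x \<notin> N" by blast
  let ?P = "vec.span {x}"
  let ?J = "{a + b |a b. a \<in> ?P \<and> b \<in> perp ?P \<inter> N}"
  have P_sub: "?P \<subseteq> N'" using x gensD(3)[OF N'] by (intro vec.span_minimal) auto
  then have P: "tot_sing ?P" by (intro tot_sing_subset[OF gensD(1)[OF N']]) auto
  have J: "?J \<in> gens" by (rule join_in_gens[OF P N])
  have sub: "vec.subspace (perp ?P \<inter> N)"
    using subspace_perp gensD(3)[OF N] vec.subspace_inter by blast
  have xJ: "x \<in> ?J"
    using subset_sums_left[OF vec.subspace_0[OF sub], of ?P] vec.span_base[of x "{x}"] by blast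
  have NJ: "perp ?P \<inter> N \<subseteq> ?J"
    using vec.span_zero by (rule subset_sums_right)
  have "x \<noteq> 0" using x gensD(3)[OF N] vec.subspace_0 by auto
  then have "vec.dim ?P = 1" by simp
  then have "n - 1 \<le> vec.dim (perp ?P \<inter> N)"
    using vec.dim_sums_Int[OF vec.subspace_span[of "{x}"] sub] gensD(2)[OF J] by simp
  also have "\<dots> \<le> vec.dim (N \<inter> ?J)"
    using NJ by (intro vec.dim_subset) blast
  finally have ge: "n - 1 \<le> vec.dim (N \<inter> ?J)" .
  have "N \<inter> ?J \<noteq> N"
  proof
    assume "N \<inter> ?J = N"
    then have "N = ?J"
      using gensD[OF N] gensD[OF J] by (intro vec.subspace_dim_equal) (simp_all only: order_refl, blast)
    then show False using xJ x by blast
  qed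
  then have "\<not> n \<le> vec.dim (N \<inter> ?J)"
    using vec.subspace_dim_equal[of "N \<inter> ?J" N] gensD[OF N] gensD[OF J] vec.subspace_inter by blast
  then have eq: "vec.dim (N \<inter> ?J) = n - 1" using ge by linarith
  have "N' \<subseteq> perp ?P"
    using tot_singD(3)[OF gensD(1)[OF N']] perp_antimono[OF P_sub] by blast
  then have "N \<inter> N' \<subseteq> ?J \<inter> N'" using NJ by blast
  moreover have "x \<in> ?J \<inter> N'" "x \<notin> N \<inter> N'" using x xJ by auto
  ultimately have "N \<inter> N' \<subset> ?J \<inter> N'" by blast
  then have "vec.dim (N \<inter> N') < vec.dim (?J \<inter> N')"
    using vec.dim_psubset[of "N \<inter> N'" "?J \<inter> N'"]
    by (simp only: span_of_subspace vec.subspace_inter gensD(3)[OF N] gensD(3)[OF N'] gensD(3)[OF J])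
  then show thesis using that[OF J eq] by blast
qed

text \<open>Move \<open>N\<close> towards \<open>N'\<close> through adjacent generators. Every step changes the parities of \<open>dim (M \<inter> N)\<close> and
of \<open>dim (N \<inter> N')\<close>, and at the end, where \<open>N = N'\<close>, the sum is \<open>2 dim (M \<inter> N) + 2 n\<close>. The statement
implies that lying in the same class is a transitive relation.\<close>

lemma gens_parity_triangle:
  assumes "N \<in> gens" "N' \<in> gens" "M \<in> gens"
  shows "even (vec.dim (M \<inter> N) + vec.dim (M \<inter> N') + vec.dim (N \<inter> N') + n)"
  using assms(1)
proof (induction "n - vec.dim (N \<inter> N')" arbitrary: N rule: less_induct)
  case less
  show ?case
  proof (cases "N = N'")
    case True
    then show ?thesis using gensD(2)[OF assms(2)] by simp
  next
    case False
    obtain K where K: "K \<in> gens" "vec.dim (N \<inter> K) = n - 1" "vec.dim (N \<inter> N') < vec.dim (K \<inter> N')"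
      using ex_adjacent_gen_closer[OF less.prems assms(2) False] .
    have "vec.dim (K \<inter> N') \<le> n"
      using vec.dim_subset[of "K \<inter> N'" K] gensD(2)[OF K(1)] by simp
    then have "even (vec.dim (M \<inter> K) + vec.dim (M \<inter> N') + vec.dim (K \<inter> N') + n)"
      using K by (intro less.hyps) auto
    moreover have "odd (vec.dim (M \<inter> N) + vec.dim (M \<inter> K))"
      by (rule adjacent_gens_parity[OF less.prems K(1,2) assms(3)])
    moreover have "odd (vec.dim (N \<inter> N') + vec.dim (K \<inter> N'))"
      using adjacent_gens_parity[OF less.prems K(1,2) assms(2)]
      unfolding Int_commute[of N' N] Int_commute[of N' K] .
    moreover have "even (a + b + c + n)"
      if "even (a' + b + c' + n)" "odd (a + a')" "odd (c + c')" for a b c a' c' :: nat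
      using that by presburger
    ultimately show ?thesis by blast
  qed
qed

text \<open>Cut the last vector off a basis of a generator in \<open>X\<close>: the other \<open>n - 1\<close> vectors determine the
generator. The count on the right-hand side does not involve \<open>X\<close>, so that all such sets \<open>X\<close> have the
same size.\<close>

lemma card_gens_of_unique_extension:
  assumes X: "X \<subseteq> gens"
    and unique: "\<And>H. tot_sing H \<Longrightarrow> vec.dim H = n - 1 \<Longrightarrow> \<exists>!G. G \<in> X \<and> H \<subseteq> G"
  shows "real (card X) * gen_bases_per_flag {n} =
    card {ws. length ws = n - 1 \<and> sing_basis ws} * extension_count {n} (n - 1)"
proof -
  let ?L = "{us \<in> gen_bases. vec.span (set us) \<in> X}" and ?W = "{ws. length ws = n - 1 \<and> sing_basis ws}"
  have fin: "finite ?W"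
    using finite_lists_length_eq[of "UNIV :: ('a ^ 'd) set" "n - 1"] by (auto elim: finite_subset[rotated])
  have fibre: "real (card {us \<in> ?L. take (n - 1) us = ws}) = extension_count {n} (n - 1)" if ws: "ws \<in> ?W" for ws
  proof -
    let ?H = "vec.span (set ws)"
    have H: "tot_sing ?H" "vec.dim ?H = n - 1" using ws by (auto simp: sing_basis_def)
    obtain G where G: "G \<in> X" "?H \<subseteq> G" and G_unique: "\<And>G'. G' \<in> X \<Longrightarrow> ?H \<subseteq> G' \<Longrightarrow> G' = G"
      using unique[OF H] by blast
    have Gg: "G \<in> gens" using G X by auto
    have "{us \<in> ?L. take (n - 1) us = ws} = {us \<in> gen_bases. adapted {G} us \<and> take (length ws) us = ws}"
    proof -
      have "?H \<subseteq> vec.span (set us)" if "take (n - 1) us = ws" for us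
        using that vec.span_mono[OF set_take_subset[of "n - 1" us]] by auto
      then have "vec.span (set us) = G"
        if "vec.span (set us) \<in> X" "take (n - 1) us = ws" for us
        using G_unique that by blast
      then show ?thesis
        using adapted_gen_iff[OF _ Gg] G ws by auto
    qed
    moreover have "set ws \<subseteq> G" using G vec.span_superset by blast
    then have "adapted {G} ws"
      using set_take_subset[of "vec.dim G" ws] by (auto simp: adapted_def)
    moreover have "{G} \<in> typed_flags {n}" using Gg by (auto simp: typed_flags_def gens_def)
    moreover have "{n - 1..<n} = {n - 1}" using n_pos by auto
    ultimately show ?thesis
      using card_adapted_extensions[of "{G}" "{n}" ws] ws by simp
  qed
  have "card ?L = (\<Sum>ws\<in>?W. card {us \<in> ?L. take (n - 1) us = ws})"
  proof (rule card_as_sum_of_fibres)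
    show "finite ?L" by simp
    show "take (n - 1) ` ?L \<subseteq> ?W" by (auto simp: gen_bases_def sing_basis_take)
  qed (rule fin)
  then have "real (card ?L) = (\<Sum>ws\<in>?W. real (card {us \<in> ?L. take (n - 1) us = ws}))"
    by (simp only: of_nat_sum)
  also have "\<dots> = (\<Sum>ws\<in>?W. extension_count {n} (n - 1))"
    by (intro sum.cong refl fibre)
  finally show ?thesis
    using card_gen_bases_span_in[OF X] by simp
qed

text \<open>Of the two generators through a totally singular subspace of dimension \<open>n - 1\<close> exactly one is in the
class of \<open>G0\<close>, by \<open>adjacent_gens_parity\<close> for \<open>M = G0\<close>. So \<open>card_gens_of_unique_extension\<close> applies to
this class and to its complement.\<close>

lemma card_gens_class:
  assumes G0: "G0 \<in> gens"
  shows "2 * card {G \<in> gens. vec.dim (G0 \<inter> G) mod 2 = n mod 2} = card gens"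
proof -
  let ?K = "{G \<in> gens. vec.dim (G0 \<inter> G) mod 2 = n mod 2}"
  have one: "(\<exists>!G. G \<in> ?K \<and> H \<subseteq> G) \<and> (\<exists>!G. G \<in> gens - ?K \<and> H \<subseteq> G)"
    if H: "tot_sing H" "vec.dim H = n - 1" for H
  proof -
    obtain N1 N2 where N: "{G \<in> gens. H \<subseteq> G} = {N1, N2}" "N1 \<noteq> N2"
      using card_gens_through_hyperplane[OF H] by (auto simp: card_2_iff)
    then have N12: "N1 \<in> gens" "N2 \<in> gens" "H \<subseteq> N1" "H \<subseteq> N2" by auto
    have "n - 1 \<le> vec.dim (N1 \<inter> N2)"
      using vec.dim_subset[of H "N1 \<inter> N2"] N12 H by simp
    moreover have "\<not> n \<le> vec.dim (N1 \<inter> N2)"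
    proof
      assume "n \<le> vec.dim (N1 \<inter> N2)"
      then have "N1 \<inter> N2 = N1" "N1 \<inter> N2 = N2"
        using vec.subspace_dim_equal[of "N1 \<inter> N2" N1] vec.subspace_dim_equal[of "N1 \<inter> N2" N2]
          gensD[OF N12(1)] gensD[OF N12(2)] vec.subspace_inter by auto
      then show False using N(2) by simp
    qed
    ultimately have "vec.dim (N1 \<inter> N2) = n - 1" by linarith
    from adjacent_gens_parity[OF N12(1,2) this G0]
    moreover have "a mod 2 = n mod 2 \<longleftrightarrow> b mod 2 \<noteq> n mod 2" if "odd (a + b)" for a b :: nat
      using that by presburger
    ultimately have "vec.dim (G0 \<inter> N1) mod 2 = n mod 2 \<longleftrightarrow> vec.dim (G0 \<inter> N2) mod 2 \<noteq> n mod 2"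
      by blast
    then have split: "N1 \<in> ?K \<longleftrightarrow> N2 \<in> gens - ?K" "N2 \<in> ?K \<longleftrightarrow> N1 \<in> gens - ?K" "N1 \<in> ?K \<or> N2 \<in> ?K"
      using N12 by blast+
    have unique: "\<exists>!G. G \<in> X \<and> H \<subseteq> G"
      if "X \<subseteq> gens" "A \<in> X" "A' \<notin> X" "{A, A'} = {N1, N2}" for X A A'
    proof (rule ex1I[of _ A])
      show "A \<in> X \<and> H \<subseteq> A" using that N12 by blast
      fix G assume "G \<in> X \<and> H \<subseteq> G"
      then have "G \<in> {A, A'}" using that(1,4) N(1) by blast
      then show "G = A" using \<open>G \<in> X \<and> H \<subseteq> G\<close> that(3) by blast
    qed
    from split(3) show ?thesis
    proof
      assume "N1 \<in> ?K"
      then have "N1 \<in> ?K" "N2 \<in> gens - ?K" using split(1) by blast+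
      then show ?thesis
        by (intro conjI unique[of ?K N1 N2] unique[of "gens - ?K" N2 N1]) auto
    next
      assume "N2 \<in> ?K"
      then have "N2 \<in> ?K" "N1 \<in> gens - ?K" using split(2) by blast+
      then show ?thesis
        by (intro conjI unique[of ?K N2 N1] unique[of "gens - ?K" N1 N2]) auto
    qed
  qed
  have "real (card ?K) * gen_bases_per_flag {n} = real (card (gens - ?K)) * gen_bases_per_flag {n}"
    using card_gens_of_unique_extension[of ?K] card_gens_of_unique_extension[of "gens - ?K"] one by auto
  then have "card ?K = card (gens - ?K)"
    using gen_bases_per_flag_pos[of "{n}"] by simp
  moreover have "card (gens - ?K) = card gens - card ?K" "card ?K \<le> card gens"
    by (auto intro: card_Diff_subset card_mono)
  ultimately show ?thesis by linarith
qed

theorem card_flags_generator_in_class: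
  assumes J: "J \<subseteq> {1..n}" "n \<in> J" and G0: "G0 \<in> gens"
  shows "2 * real (card {f \<in> typed_flags J. \<exists>N\<in>f. vec.dim N = n \<and>
      N \<in> {G \<in> gens. vec.dim (G0 \<inter> G) mod 2 = n mod 2}}) = real (card (typed_flags J))"
proof -
  let ?K = "{G \<in> gens. vec.dim (G0 \<inter> G) mod 2 = n mod 2}"
  let ?c = "real (card {f \<in> typed_flags J. \<exists>N\<in>f. vec.dim N = n \<and> N \<in> ?K})"
  have gens: "real (card gens) = 2 * real (card ?K)"
    using card_gens_class[OF G0] by linarith
  have "?c * card gens = real (card ?K) * card (typed_flags J)"
    by (rule card_flags_generator_in[OF J]) auto
  moreover have "real (card ?K) > 0" using gens card_gens_pos by linarith
  moreover have "2 * c = f" if "c * g = k * f" "g = 2 * k" "0 < k" for c f g k :: real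
    using that by simp
  ultimately show ?thesis using gens by blast
qed

end

section \<open>Opposite flags\<close>

context singular_geometry
begin

text \<open>A linear combination of the \<open>x i\<close> that is orthogonal to every \<open>y i\<close> has all coefficients zero.\<close>

lemma span_inter_perp_dual_family:
  assumes I: "finite I"
    and off: "\<And>i j. i \<in> I \<Longrightarrow> j \<in> I \<Longrightarrow> i \<noteq> j \<Longrightarrow> B (x i) (y j) = 0"
    and diag: "\<And>i. i \<in> I \<Longrightarrow> B (x i) (y i) \<noteq> 0"
    and v: "v \<in> vec.span (x ` I)" "v \<in> perp (y ` I)"
  shows "v = 0"
  using assms
proof (induction I arbitrary: v)
  case (insert i I)
  obtain c where c: "v - c *s x i \<in> vec.span (x ` I)"
    using insert.prems(3) by (auto simp: vec.span_insert)
  have "x ` I \<subseteq> perp {y i}"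
    using insert.prems(1) insert.hyps(2) by (auto simp: perp_def)
  then have "vec.span (x ` I) \<subseteq> perp {y i}"
    by (intro vec.span_minimal subspace_perp)
  then have "B (v - c *s x i) (y i) = 0"
    using c by (auto simp: perp_def)
  moreover have "B v (y i) = B (v - c *s x i) (y i) + c * B (x i) (y i)"
    by (simp flip: B_add_left B_scale_left)
  moreover have "B v (y i) = 0"
    using insert.prems(4) by (simp add: perp_def)
  ultimately have "c = 0" using insert.prems(2)[of i] by simp
  then show ?case
    using c insert.prems insert.IH[of v] by (simp add: perp_def)
qed simp

text \<open>The frame points with negative indices span a subspace orthogonal to each of them, and each of them is
orthogonal to all frame points with positive indices except the one of opposite index. So
\<open>span_inter_perp_dual_family\<close> applies to spanning vectors of the frame points.\<close>

lemma frame_halves_inter_trivial: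
  fixes P :: "int \<Rightarrow> ('a ^ 'd) set"
  assumes points: "\<And>i. i \<in> frame_indices n \<Longrightarrow> tot_sing (P i) \<and> vec.dim (P i) = 1"
    and frame: "\<And>i j. i \<in> frame_indices n \<Longrightarrow> j \<in> frame_indices n \<Longrightarrow>
      tot_sing (vec.span (P i \<union> P j)) \<longleftrightarrow> j \<noteq> - i"
  shows "vec.span (\<Union>j\<in>{1..int n}. P j) \<inter> vec.span (\<Union>j\<in>{1..int n}. P (- j)) = {0}"
proof -
  let ?I = "{1..int n}"
  have "\<exists>x. P i = vec.span {x}" if i: "i \<in> frame_indices n" for i
  proof -
    have P: "vec.subspace (P i)" "vec.dim (P i) = 1" using points[OF i] tot_singD(1) by blast+
    have "P i \<noteq> {0}"
    proof
      assume "P i = {0}"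
      then show False using P(2) by simp
    qed
    then obtain x where x: "x \<in> P i" "x \<noteq> 0" using vec.subspace_0[OF P(1)] by blast
    then have "vec.span {x} = P i"
      using P vec.span_minimal[of "{x}" "P i"] by (intro vec.subspace_dim_equal) auto
    then show ?thesis by blast
  qed
  then obtain x where x: "\<And>i. i \<in> frame_indices n \<Longrightarrow> P i = vec.span {x i}" by metis
  have xP: "x i \<in> P i" if "i \<in> frame_indices n" for i
    using x[OF that] vec.span_base[of "x i" "{x i}"] by simp
  have orth: "B (x i) (x j) = 0" if ij: "i \<in> frame_indices n" "j \<in> frame_indices n" "j \<noteq> - i" for i j
  proof -
    have "tot_sing (vec.span (P i \<union> P j))" using frame ij by blast
    moreover have "x i \<in> vec.span (P i \<union> P j)" "x j \<in> vec.span (P i \<union> P j)"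
      using xP ij by (auto intro: vec.span_base)
    ultimately show ?thesis using tot_singD(3) by (fastforce simp: perp_def)
  qed
  have not_orth: "B (x i) (x (- i)) \<noteq> 0" if i: "i \<in> frame_indices n" for i
  proof
    assume zero: "B (x i) (x (- i)) = 0"
    have i': "- i \<in> frame_indices n" using i by (auto simp: frame_indices_def)
    have "x (- i) \<in> perp {x i}" using zero orthogonal_sym by (simp add: perp_def)
    then have "x (- i) \<in> perp (P i)" using x[OF i] by (simp add: perp_span)
    moreover have "S (x (- i))" using tot_singD(2) points[OF i'] xP[OF i'] by blast
    ultimately have ts: "tot_sing (vec.span (insert (x (- i)) (P i)))"
      using points[OF i] by (intro tot_sing_insert) auto
    have "vec.span {x (- i)} \<subseteq> vec.span (insert (x (- i)) (P i))"
      by (intro vec.span_mono) simp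
    then have "P i \<union> P (- i) \<subseteq> vec.span (insert (x (- i)) (P i))"
      using x[OF i'] vec.span_superset[of "insert (x (- i)) (P i)"] by auto
    then have "vec.span (P i \<union> P (- i)) \<subseteq> vec.span (insert (x (- i)) (P i))"
      by (intro vec.span_minimal) auto
    then have "tot_sing (vec.span (P i \<union> P (- i)))"
      by (intro tot_sing_subset[OF ts]) auto
    then show False using frame[OF i i'] by simp
  qed
  have I: "i \<in> frame_indices n" "- i \<in> frame_indices n" if "i \<in> ?I" for i
    using that by (auto simp: frame_indices_def)
  have span: "vec.span (\<Union>j\<in>?I. P (s j)) = vec.span ((\<lambda>j. x (s j)) ` ?I)"
    if s: "\<And>j. j \<in> ?I \<Longrightarrow> s j \<in> frame_indices n" for s :: "int \<Rightarrow> int"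
  proof
    have "P (s j) \<subseteq> vec.span ((\<lambda>j. x (s j)) ` ?I)" if "j \<in> ?I" for j
      unfolding x[OF s[OF that]] using that by (intro vec.span_mono) auto
    then show "vec.span (\<Union>j\<in>?I. P (s j)) \<subseteq> vec.span ((\<lambda>j. x (s j)) ` ?I)"
      by (intro vec.span_minimal UN_least vec.subspace_span)
    show "vec.span ((\<lambda>j. x (s j)) ` ?I) \<subseteq> vec.span (\<Union>j\<in>?I. P (s j))"
      using xP s by (intro vec.span_mono) auto
  qed
  have "v = 0"
    if v: "v \<in> vec.span ((\<lambda>j. x j) ` ?I)" "v \<in> vec.span ((\<lambda>j. x (- j)) ` ?I)" for v
  proof -
    have "(\<lambda>j. x (- j)) ` ?I \<subseteq> perp ((\<lambda>j. x (- j)) ` ?I)"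
      using orth I by (force simp: perp_def)
    then have "vec.span ((\<lambda>j. x (- j)) ` ?I) \<subseteq> perp ((\<lambda>j. x (- j)) ` ?I)"
      by (intro vec.span_minimal subspace_perp)
    then show ?thesis
      using v orth not_orth I by (intro span_inter_perp_dual_family[of ?I x "\<lambda>j. x (- j)"]) auto
  qed
  then have "vec.span ((\<lambda>j. x j) ` ?I) \<inter> vec.span ((\<lambda>j. x (- j)) ` ?I) \<subseteq> {0}"
    by (intro subsetI) (elim IntE, simp only: singleton_iff)
  moreover have "{0} \<subseteq> vec.span ((\<lambda>j. x j) ` ?I) \<inter> vec.span ((\<lambda>j. x (- j)) ` ?I)"
    by (simp add: vec.span_zero)
  ultimately show ?thesis
    using span[of "\<lambda>j. j", OF I(1)] span[of uminus, OF I(2)] by (simp only: subset_antisym)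
qed

end

lemma isometry_id: "isometry \<Phi> (\<lambda>v. v)"
  unfolding isometry_def using vec.linear_ident bij_id by (cases \<Phi>) (auto simp: id_def)

lemma isometry_comp: "isometry \<Phi> f \<Longrightarrow> isometry \<Phi> g \<Longrightarrow> isometry \<Phi> (f \<circ> g)"
  unfolding isometry_def
  by (cases \<Phi>) (auto intro: Vector_Spaces.linear_compose bij_comp)

lemma isometry_totally_singular:
  "isometry \<Phi> f \<Longrightarrow> totally_singular \<Phi> (f ` U) \<longleftrightarrow> totally_singular \<Phi> U"
  by (cases \<Phi>) (auto simp: isometry_def)

lemma isometry_span:
  assumes "isometry \<Phi> f"
  shows "f ` vec.span X = vec.span (f ` X)"
proof -
  interpret f: Vector_Spaces.linear "(*s)" "(*s)" f using assms by (simp add: isometry_def)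
  show ?thesis by (rule f.span_image[symmetric])
qed

lemma isometry_dim:
  assumes "isometry \<Phi> f"
  shows "vec.dim (f ` X) = vec.dim X"
proof (rule vec.dim_image_eq)
  show "Vector_Spaces.linear (*s) (*s) f" using assms by (simp add: isometry_def)
  have "inj f" using assms by (simp add: isometry_def bij_is_inj)
  then show "inj_on f (vec.span X)" by (rule inj_on_subset) simp
qed

text \<open>Surjectivity is recorded because the definition of opposition inverts elements of the group.\<close>

lemma polar_group_induced:
  assumes "g \<in> polar_group \<Phi>"
  shows "\<exists>f. isometry \<Phi> f \<and> (\<forall>U. vec.subspace U \<longrightarrow> g U = f ` U) \<and> surj g"
proof -
  obtain f where f: "isometry \<Phi> f" "g = (\<lambda>U. if vec.subspace U then f ` U else U)"
    using assms by (auto simp: polar_group_def)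
  interpret f: Vector_Spaces.linear "(*s)" "(*s)" f using f by (simp add: isometry_def)
  have "\<exists>V. g V = U" for U
  proof (cases "vec.subspace U")
    case True
    have "f ` (f -` U) = U" using f(1) by (simp add: isometry_def bij_is_surj surj_image_vimage_eq)
    then have "g (f -` U) = U" using f.subspace_vimage[OF True] f(2) by simp
    then show ?thesis by blast
  next
    case False
    then show ?thesis using f(2) by (intro exI[of _ U]) simp
  qed
  then have "surj g" by (metis surj_def)
  then show ?thesis using f by auto
qed

text \<open>From \<open>h\<^sup>-\<^sup>1 g = b1 w b2\<close> with \<open>b1, b2\<close> in the stabilizer of the frame flag \<open>F\<close> it follows that
\<open>g F = (h b1) (w F)\<close> and \<open>h F = (h b1) F\<close>; the isometry is the one that induces \<open>h b1\<close>.\<close>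

lemma opposite_maximal_flags_imp_isometry:
  assumes fr: "\<And>i. i \<in> frame_indices n \<Longrightarrow> vec.subspace (fr i)"
    and opp: "opposite_maximal_flags \<Phi> n fr F1 F2"
  obtains f where "isometry \<Phi> f" "F1 = (`) f ` frame_flag n (\<lambda>i. fr (- i))" "F2 = (`) f ` frame_flag n fr"
proof -
  let ?B = "borel_subgroup \<Phi> n fr" and ?F = "frame_flag n fr"
  obtain g h w where gh: "g \<in> polar_group \<Phi>" "h \<in> polar_group \<Phi>" "w \<in> polar_group \<Phi>"
      "F1 = g ` ?F" "F2 = h ` ?F"
    and w: "\<And>i. i \<in> frame_indices n \<Longrightarrow> w (fr i) = fr (- i)"
    and cosets: "double_coset ?B (inv h \<circ> g) = double_coset ?B w"
    using opp unfolding opposite_maximal_flags_def Let_def by blast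
  have "id = (\<lambda>U. if vec.subspace U then (\<lambda>v. v) ` U else U)" by (intro ext) simp
  then have "id \<in> polar_group \<Phi>" unfolding polar_group_def using isometry_id by blast
  then have "id \<in> ?B" unfolding borel_subgroup_def by simp
  then have "id \<circ> (inv h \<circ> g) \<circ> id \<in> double_coset ?B (inv h \<circ> g)"
    unfolding double_coset_def by blast
  then have "inv h \<circ> g \<in> double_coset ?B (inv h \<circ> g)"
    by (simp only: id_comp comp_id)
  then have "inv h \<circ> g \<in> double_coset ?B w"
    by (simp only: cosets)
  then obtain b1 b2 where b: "b1 \<in> ?B" "b2 \<in> ?B" "inv h \<circ> g = b1 \<circ> w \<circ> b2"
    unfolding double_coset_def by blast
  obtain fh where fh: "isometry \<Phi> fh" "\<And>U. vec.subspace U \<Longrightarrow> h U = fh ` U" "surj h"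
    using polar_group_induced[OF gh(2)] by blast
  obtain fb where fb: "isometry \<Phi> fb" "\<And>U. vec.subspace U \<Longrightarrow> b1 U = fb ` U"
  proof -
    have "b1 \<in> polar_group \<Phi>" using b(1) by (simp add: borel_subgroup_def)
    from polar_group_induced[OF this] show thesis using that by blast
  qed
  obtain fw where fw: "isometry \<Phi> fw" "\<And>U. vec.subspace U \<Longrightarrow> w U = fw ` U"
    using polar_group_induced[OF gh(3)] by blast
  have b_fix: "b1 ` ?F = ?F" "b2 ` ?F = ?F" using b by (auto simp: borel_subgroup_def)
  have "g U = h (b1 (w (b2 U)))" for U
    using fun_cong[OF b(3), of U] surj_f_inv_f[OF fh(3)] by (metis comp_apply)
  then have F1: "F1 = (\<lambda>U. h (b1 U)) ` w ` b2 ` ?F"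
    using gh(4) by (simp add: image_image)
  have wU: "w (vec.span (\<Union>j\<in>{1..int i}. fr j)) = vec.span (\<Union>j\<in>{1..int i}. fr (- j))"
    if "i \<in> {1..n}" for i
  proof -
    have "fw ` fr j = fr (- j)" if "j \<in> {1..int i}" for j
      using w[of j] fw(2)[OF fr, of j] that \<open>i \<in> {1..n}\<close> by (auto simp: frame_indices_def)
    then have "fw ` (\<Union>j\<in>{1..int i}. fr j) = (\<Union>j\<in>{1..int i}. fr (- j))"
      by (simp add: image_UN)
    then show ?thesis
      using fw(2)[OF vec.subspace_span] isometry_span[OF fw(1)] by simp
  qed
  have wF: "w ` ?F = frame_flag n (\<lambda>i. fr (- i))"
    unfolding frame_flag_def using wU by (auto simp: image_iff)
  have sub: "vec.subspace U" if "U \<in> frame_flag n fr'" for U fr'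
    using that by (auto simp: frame_flag_def)
  have hb: "h (b1 U) = (fh \<circ> fb) ` U" if "vec.subspace U" for U
  proof -
    interpret fb: Vector_Spaces.linear "(*s)" "(*s)" fb using fb by (simp add: isometry_def)
    show ?thesis
      using fh(2)[OF fb.subspace_image[OF that]] fb(2)[OF that] by (simp add: image_image)
  qed
  have "F1 = (`) (fh \<circ> fb) ` frame_flag n (\<lambda>i. fr (- i))"
    unfolding F1 b_fix wF by (intro image_cong refl hb sub)
  moreover have "F2 = (\<lambda>U. h (b1 U)) ` ?F"
    unfolding gh(5) using b_fix(1) by (metis image_image)
  then have "F2 = (`) (fh \<circ> fb) ` ?F"
    by (simp only:) (intro image_cong refl hb sub)
  ultimately show thesis
    using that isometry_comp[OF fh(1) fb(1)] by blast
qed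

text \<open>Up to an isometry the two points are \<open>\<langle>e\<^bsub>-1\<^esub>\<rangle>\<close> and \<open>\<langle>e\<^sub>1\<rangle>\<close>.\<close>

lemma opposite_points_not_collinear:
  assumes frame: "polar_frame \<Phi> n fr" and n: "1 \<le> n"
    and opp: "opposite_flags \<Phi> n fr f1 f2"
    and P1: "P1 \<in> f1" "vec.dim P1 = 1" and P2: "P2 \<in> f2" "vec.dim P2 = 1"
  shows "\<not> totally_singular \<Phi> (vec.span (P1 \<union> P2))"
proof -
  have fr: "vec.subspace (fr i)" "vec.dim (fr i) = 1" if "i \<in> frame_indices n" for i
    using frame that by (auto simp: polar_frame_def polar_points_def polar_subspaces_def)
  have idx: "1 \<in> frame_indices n" "- 1 \<in> frame_indices n"
    using n by (auto simp: frame_indices_def)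
  obtain F1 F2 where F: "f1 \<subseteq> F1" "f2 \<subseteq> F2" "opposite_maximal_flags \<Phi> n fr F1 F2"
    using opp by (auto simp: opposite_flags_def)
  obtain f where f: "isometry \<Phi> f" "F1 = (`) f ` frame_flag n (\<lambda>i. fr (- i))" "F2 = (`) f ` frame_flag n fr"
    using opposite_maximal_flags_imp_isometry[OF fr(1) F(3)] by blast
  have point: "P = f ` fr' 1"
    if P: "P \<in> (`) f ` frame_flag n fr'" "vec.dim P = 1" and fr': "vec.subspace (fr' 1)" "vec.dim (fr' 1) = 1"
    for P and fr' :: "int \<Rightarrow> ('a ^ 'b) set"
  proof -
    obtain i where i: "i \<in> {1..n}" "P = f ` vec.span (\<Union>j\<in>{1..int i}. fr' j)"
      using P(1) by (auto simp: frame_flag_def)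
    have "fr' 1 \<subseteq> (\<Union>j\<in>{1..int i}. fr' j)"
      using i(1) by (intro UN_upper) auto
    then have sub: "fr' 1 \<subseteq> vec.span (\<Union>j\<in>{1..int i}. fr' j)"
      using vec.span_superset by blast
    have "vec.dim (vec.span (\<Union>j\<in>{1..int i}. fr' j)) = 1"
      using P(2) isometry_dim[OF f(1)] unfolding i(2) by simp
    then have "fr' 1 = vec.span (\<Union>j\<in>{1..int i}. fr' j)"
      using fr' by (intro vec.subspace_dim_equal sub vec.subspace_span) simp_all
    then show ?thesis using i(2) by simp
  qed
  have "P1 = f ` fr (- 1)"
    using point[of P1 "\<lambda>i. fr (- i)"] P1 F(1) f(2) fr[OF idx(2)] by auto
  moreover have "P2 = f ` fr 1"
    using point[of P2 fr] P2 F(2) f(3) fr[OF idx(1)] by auto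
  ultimately have "vec.span (P1 \<union> P2) = f ` vec.span (fr (- 1) \<union> fr 1)"
    using isometry_span[OF f(1), of "fr (- 1) \<union> fr 1"] by (simp add: image_Un)
  moreover have "\<not> totally_singular \<Phi> (vec.span (fr (- 1) \<union> fr 1))"
    using frame idx by (auto simp: polar_frame_def collinear_points_def)
  ultimately show ?thesis using isometry_totally_singular[OF f(1)] by simp
qed

text \<open>Up to an isometry the members of the two flags lie in the two halves of the frame.\<close>

lemma opposite_members_disjoint:
  fixes \<Phi> :: "('a::{field,finite}, 'a ^ 'd::finite) form"
  assumes frame: "polar_frame \<Phi> n fr"
    and geo: "singular_geometry B S \<theta>"
    and ts: "\<And>U. vec.subspace U \<Longrightarrow> totally_singular \<Phi> U \<longleftrightarrow> singular_geometry.tot_sing B S U"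
    and opp: "opposite_flags \<Phi> n fr f1 f2"
    and N: "N1 \<in> f1" "N2 \<in> f2"
  shows "N1 \<inter> N2 \<subseteq> {0}"
proof -
  interpret singular_geometry B S \<theta> by (rule geo)
  have fr: "vec.subspace (fr i)" "tot_sing (fr i) \<and> vec.dim (fr i) = 1" if "i \<in> frame_indices n" for i
    using frame that ts by (auto simp: polar_frame_def polar_points_def polar_subspaces_def)
  have "tot_sing (vec.span (fr i \<union> fr j)) \<longleftrightarrow> j \<noteq> - i"
    if "i \<in> frame_indices n" "j \<in> frame_indices n" for i j
    using frame that ts[OF vec.subspace_span] by (auto simp: polar_frame_def collinear_points_def)
  note disjoint = frame_halves_inter_trivial[OF fr(2) this]
  obtain F1 F2 where F: "f1 \<subseteq> F1" "f2 \<subseteq> F2" "opposite_maximal_flags \<Phi> n fr F1 F2"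
    using opp by (auto simp: opposite_flags_def)
  obtain f where f: "isometry \<Phi> f" "F1 = (`) f ` frame_flag n (\<lambda>i. fr (- i))" "F2 = (`) f ` frame_flag n fr"
    using opposite_maximal_flags_imp_isometry[OF fr(1) F(3)] by blast
  have sub: "N \<subseteq> f ` vec.span (\<Union>j\<in>{1..int n}. fr' j)" if N: "N \<in> (`) f ` frame_flag n fr'"
    for N and fr' :: "int \<Rightarrow> ('a ^ 'd) set"
  proof -
    obtain i where i: "i \<in> {1..n}" "N = f ` vec.span (\<Union>j\<in>{1..int i}. fr' j)"
      using N by (auto simp: frame_flag_def)
    show ?thesis unfolding i(2)
      using i(1) by (intro image_mono vec.span_mono UN_mono) auto
  qed
  have "N1 \<subseteq> f ` vec.span (\<Union>j\<in>{1..int n}. fr (- j))" "N2 \<subseteq> f ` vec.span (\<Union>j\<in>{1..int n}. fr j)"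
    using sub N F f by blast+
  then have "N1 \<inter> N2 \<subseteq> f ` (vec.span (\<Union>j\<in>{1..int n}. fr j) \<inter> vec.span (\<Union>j\<in>{1..int n}. fr (- j)))"
    using f(1) by (subst image_Int) (auto simp: isometry_def bij_is_inj)
  also have "\<dots> = f ` {0}" by (simp only: disjoint)
  also have "\<dots> = {0}"
  proof -
    interpret f: Vector_Spaces.linear "(*s)" "(*s)" f using f(1) by (simp add: isometry_def)
    show ?thesis by (simp add: f.zero)
  qed
  finally show ?thesis .
qed

section \<open>The three kinds of forms\<close>

lemma alternating_geometry:
  assumes b: "alternating_form b" and nd: "nondegenerate (Alternating b)"
  shows "singular_geometry b (\<lambda>_. True) 1"
proof (rule singular_geometry.intro)
  have lin: "Vector_Spaces.linear (*s) (*) (\<lambda>u. b u v)" "Vector_Spaces.linear (*s) (*) (\<lambda>v. b u v)"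
    and alt: "b v v = 0" for u v
    using b by (auto simp: alternating_form_def bilinear_form_def)
  show "Vector_Spaces.linear (*s) (*) (\<lambda>u. b u v)" for v by (rule lin)
  have skew: "b u v + b v u = 0" for u v
  proof -
    interpret l: Vector_Spaces.linear "(*s)" "(*)" "\<lambda>x. b x (u + v)" by (rule lin)
    interpret l1: Vector_Spaces.linear "(*s)" "(*)" "\<lambda>x. b u x" by (rule lin)
    interpret l2: Vector_Spaces.linear "(*s)" "(*)" "\<lambda>x. b v x" by (rule lin)
    have "b (u + v) (u + v) = (b u u + b u v) + (b v u + b v v)"
      by (simp only: l.add l1.add l2.add)
    then show ?thesis by (simp add: alt)
  qed
  show "b v u = 0" if "b u v = 0" for u v using skew[of u v] that by simp
  show "b v v = 0" for v by (rule alt)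
  show "v = 0" if "\<And>u. b v u = 0" for v using nd that by simp
qed auto

text \<open>For singular \<open>u\<close> the value \<open>Q (v + u)\<close> is \<open>Q v\<close> plus a linear functional of \<open>u\<close>, so that one value of
this functional out of \<open>q\<close> makes \<open>v + u\<close> singular.\<close>

lemma quadratic_geometry:
  fixes Q :: "'a::{field,finite} ^ 'd::finite \<Rightarrow> 'a"
  assumes Q: "quadratic_form Q" and nd: "nondegenerate (Quadratic Q)"
  shows "singular_geometry (polarization Q) (\<lambda>v. Q v = 0) (1 / CARD('a))"
proof (rule singular_geometry.intro)
  have scale: "Q (c *s v) = c\<^sup>2 * Q v" for c v using Q by (simp add: quadratic_form_def)
  have lin: "Vector_Spaces.linear (*s) (*) (\<lambda>u. polarization Q u v)" for v
    using Q by (simp add: quadratic_form_def bilinear_form_def)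
  show "Vector_Spaces.linear (*s) (*) (\<lambda>u. polarization Q u v)" for v by (rule lin)
  have sym: "polarization Q u v = polarization Q v u" for u v by (simp add: polarization_def add.commute)
  show "polarization Q v u = 0" if "polarization Q u v = 0" for u v using that sym by simp
  show Q0: "Q 0 = 0" using scale[of 0 0] by simp
  show "Q (c *s v) = 0" if "Q v = 0" for c v using that scale by simp
  show "Q (u + v) = 0" if "Q u = 0" "Q v = 0" "polarization Q u v = 0" for u v
    using that by (simp add: polarization_def)
  show "polarization Q v v = 0" if "Q v = 0" for v
    using that scale[of 2 v] by (simp add: polarization_def flip: vec.scale_left_distrib[of 1 1, simplified])
  show "v = 0" if "Q v = 0" "\<And>u. polarization Q v u = 0" for v using nd that by auto
  show "real (card {u \<in> U. Q (v + u) = 0}) = 1 / real CARD('a) * real (card U)"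
    if U: "vec.subspace U" "\<And>u. u \<in> U \<Longrightarrow> Q u = 0" "u0 \<in> U" "polarization Q u0 v \<noteq> 0" for U u0 v
  proof -
    have "Q (v + u) = Q v + polarization Q u v" if "u \<in> U" for u
      using U(2)[OF that] by (simp add: polarization_def add.commute)
    then have "{u \<in> U. Q (v + u) = 0} = {u \<in> U. polarization Q u v = - Q v}"
      by (auto simp: eq_neg_iff_add_eq_0 add.commute)
    moreover have "CARD('a) * card {u \<in> U. polarization Q u v = - Q v} = card U"
      by (rule card_functional_fibre[OF lin U(1,3,4)])
    then have "real CARD('a) * real (card {u \<in> U. polarization Q u v = - Q v}) = real (card U)"
      by (simp only: flip: of_nat_mult)
    ultimately show ?thesis by (simp add: field_simps)
  qed
qed auto

text \<open>For isotropic \<open>u\<close> the value \<open>h (v + u) (v + u)\<close> is \<open>h v v\<close> plus the trace \<open>x + x\<^sup>r\<close> of \<open>x = h u v\<close>, and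
\<open>- h v v\<close> is the trace of exactly \<open>r\<close> out of the \<open>r\<^sup>2\<close> field elements.\<close>

lemma hermitian_geometry:
  fixes h :: "'a::{field,finite} ^ 'd::finite \<Rightarrow> 'a ^ 'd \<Rightarrow> 'a"
  assumes r: "CARD('a) = r\<^sup>2"
    and lin: "\<And>v. Vector_Spaces.linear (*s) (*) (\<lambda>u. h u v)"
    and conj: "\<And>u v. h v u = h u v ^ r"
    and nd: "nondegenerate (Hermitian h)"
  shows "singular_geometry h (\<lambda>v. h v v = 0) (1 / r)"
proof (rule singular_geometry.intro)
  have r0: "r > 0" using r finite_UNIV_card_ge_0[where 'a = 'a] by (cases r) auto
  have left: "h (u + w) v = h u v + h w v" "h (c *s u) v = c * h u v" "h 0 v = 0" for u w v c
  proof -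
    interpret l: Vector_Spaces.linear "(*s)" "(*)" "\<lambda>x. h x v" by (rule lin)
    show "h (u + w) v = h u v + h w v" "h (c *s u) v = c * h u v" "h 0 v = 0"
      by (rule l.add l.scale l.zero)+
  qed
  have right: "h v (u + w) = h v u + h v w" for u v w
    by (subst (1 2 3) conj) (simp only: left power_add_sqrt_card[OF r])
  show "Vector_Spaces.linear (*s) (*) (\<lambda>u. h u v)" for v by (rule lin)
  show sym: "h v u = 0" if "h u v = 0" for u v using conj[of v u] that r0 by simp
  show "h 0 0 = 0" by (rule left)
  show "h (c *s v) (c *s v) = 0" if "h v v = 0" for c v
    using sym[of "c *s v" v] that by (simp only: left) simp
  show "h (u + v) (u + v) = 0" if "h u u = 0" "h v v = 0" "h u v = 0" for u v
    using that sym[of u v] by (simp add: left right)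
  show "v = 0" if "\<And>u. h v u = 0" for v using nd that by simp
  show "real (card {u \<in> U. h (v + u) (v + u) = 0}) = 1 / real r * real (card U)"
    if U: "vec.subspace U" "\<And>u. u \<in> U \<Longrightarrow> h u u = 0" "u0 \<in> U" "h u0 v \<noteq> 0" for U u0 v
  proof -
    let ?T = "{x::'a. x + x ^ r = - h v v}" and ?L = "{u \<in> U. h (v + u) (v + u) = 0}"
    have "h (v + u) (v + u) = h v v + (h u v + h u v ^ r)" if "u \<in> U" for u
      using U(2)[OF that] conj[of u v] conj[of v u] by (simp add: left right)
    then have L: "?L = {u \<in> U. h u v \<in> ?T}"
      by (auto simp: eq_neg_iff_add_eq_0 add.commute)
    have "(- h v v) ^ r = - h v v"
    proof -
      have "(- h v v) ^ r + h v v ^ r = 0"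
        using power_add_sqrt_card[OF r, of "- h v v" "h v v"] zero_power[OF r0, where 'a = 'a] by simp
      then have "(- h v v) ^ r + h v v = 0" using conj[of v v] by metis
      then show ?thesis by (simp add: eq_neg_iff_add_eq_0)
    qed
    then have T: "card ?T = r" by (rule card_trace_fibre[OF r])
    have "card ?L = (\<Sum>x\<in>?T. card {u \<in> ?L. h u v = x})"
      unfolding L by (intro card_as_sum_of_fibres) auto
    also have "\<dots> = (\<Sum>x\<in>?T. card {u \<in> U. h u v = x})"
      unfolding L by (intro sum.cong refl arg_cong[where f = card]) auto
    finally have "CARD('a) * card ?L = (\<Sum>x\<in>?T. CARD('a) * card {u \<in> U. h u v = x})"
      by (simp only: sum_distrib_left)
    also have "\<dots> = (\<Sum>x\<in>?T. card U)"
      by (intro sum.cong refl card_functional_fibre[OF lin U(1,3,4)])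
    also have "\<dots> = r * card U" using T by simp
    finally have "r * (r * card ?L) = r * card U"
      using r by (simp add: power2_eq_square mult.assoc)
    then have "real r * real (card ?L) = real (card U)"
      using r0 by (simp flip: of_nat_mult)
    then show ?thesis using r0 by (simp add: field_simps)
  qed
qed auto

lemma polar_e_eq_0_iff: "polar_e k = 0 \<longleftrightarrow> k = Hyperbolic"
  by (cases k) auto

text \<open>The parameter \<open>e\<close> is the one number that makes \<open>\<theta> q ^ (d - n) = q powr (n + e - 1)\<close>: it combines the
proportion \<open>\<theta>\<close> with the dimension \<open>d\<close>. In the hermitian cases \<open>\<theta> = q powr (- 1 / 2)\<close>.\<close>

lemma classical_polar_space_geometry:
  fixes \<Phi> :: "('a::{field,finite}, 'a ^ 'd::finite) form"
  assumes cps: "classical_polar_space k n \<Phi>"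
  shows "\<exists>B S \<theta>. singular_geometry_of_rank B S \<theta> n \<and>
    (\<forall>U. vec.subspace U \<longrightarrow> totally_singular \<Phi> U = singular_geometry.tot_sing B S U) \<and>
    \<theta> * real CARD('a) ^ (CARD('d) - n) = real CARD('a) powr (real n + polar_e k - 1) \<and>
    (k = Hyperbolic \<longrightarrow> CARD('d) = 2 * n \<and> \<theta> * real CARD('a) = 1)"
proof -
  let ?q = "real CARD('a)"
  have q: "?q > 0" by simp
  have nd: "nondegenerate \<Phi>" and witt: "witt_index \<Phi> = n"
    using cps by (auto simp: classical_polar_space_def)
  have "\<exists>B S \<theta>. singular_geometry B S \<theta> \<and>
      (\<forall>U. vec.subspace U \<longrightarrow> totally_singular \<Phi> U = ((\<forall>u\<in>U. S u) \<and> (\<forall>u\<in>U. \<forall>v\<in>U. B u v = 0))) \<and>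
      \<theta> * ?q ^ (CARD('d) - n) = ?q powr (real n + polar_e k - 1) \<and>
      (k = Hyperbolic \<longrightarrow> CARD('d) = 2 * n \<and> \<theta> * ?q = 1)"
  proof (cases \<Phi>)
    case (Alternating b)
    then have k: "k = Symplectic" "alternating_form b" "CARD('d) = 2 * n"
      using cps by (auto simp: classical_polar_space_def split: polar_kind.splits)
    show ?thesis
      using alternating_geometry[OF k(2)] nd Alternating k q
      by (intro exI[of _ b] exI[of _ "\<lambda>_. True"] exI[of _ 1]) (auto simp: powr_realpow)
  next
    case (Hermitian h)
    then have k: "k = Hermitian_Even \<and> CARD('d) = 2 * n \<or> k = Hermitian_Odd \<and> CARD('d) = 2 * n + 1"
      and h: "hermitian_form h"
      using cps by (auto simp: classical_polar_space_def split: polar_kind.splits)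
    from h obtain r where r: "CARD('a) = r\<^sup>2" "\<And>v. Vector_Spaces.linear (*s) (*) (\<lambda>u. h u v)"
      "\<And>u v. h v u = h u v ^ r"
      unfolding hermitian_form_def by blast
    have geo: "singular_geometry h (\<lambda>v. h v v = 0) (1 / r)"
      using nd Hermitian by (intro hermitian_geometry r) auto
    have r_pos: "real r > 0" using q r(1) by (cases r) auto
    have q_half: "?q = real r powr 2"
      using r(1) r_pos by (simp add: powr_numeral)
    have e: "CARD('d) - n = (if k = Hermitian_Even then n else n + 1)"
      "polar_e k = (if k = Hermitian_Even then 1 / 2 else 3 / 2)"
      using k by auto
    have "1 / r * ?q ^ (CARD('d) - n) = ?q powr (real n + polar_e k - 1)"
    proof -
      have "1 / r * ?q ^ m = ?q powr (real m - 1 / 2)" for m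
        using q r_pos by (simp add: powr_diff powr_realpow powr_half_sqrt r(1))
      then show ?thesis using e by (auto split: if_splits)
    qed
    then show ?thesis
      using geo Hermitian k
      by (intro exI[of _ h] exI[of _ "\<lambda>v. h v v = 0"] exI[of _ "1 / r"]) auto
  next
    case (Quadratic Q)
    then have k: "k = Hyperbolic \<and> CARD('d) = 2 * n \<or> k = Parabolic \<and> CARD('d) = 2 * n + 1 \<or>
        k = Elliptic \<and> CARD('d) = 2 * n + 2"
      and Q: "quadratic_form Q"
      using cps by (auto simp: classical_polar_space_def split: polar_kind.splits)
    have geo: "singular_geometry (polarization Q) (\<lambda>v. Q v = 0) (1 / CARD('a))"
      using nd Quadratic by (intro quadratic_geometry Q) auto
    have "real (CARD('d) - n) = real n + polar_e k" using k by auto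
    moreover have "1 / CARD('a) * ?q ^ m = ?q powr (real m - 1)" for m
      using q by (simp add: powr_diff powr_realpow)
    ultimately have "1 / CARD('a) * ?q ^ (CARD('d) - n) = ?q powr (real n + polar_e k - 1)"
      by metis
    moreover have "totally_singular \<Phi> U = ((\<forall>u\<in>U. Q u = 0) \<and> (\<forall>u\<in>U. \<forall>v\<in>U. polarization Q u v = 0))"
      if "vec.subspace U" for U
      using Quadratic vec.subspace_add[OF that] by (auto simp: polarization_def)
    ultimately show ?thesis
      using geo k
      by (intro exI[of _ "polarization Q"] exI[of _ "\<lambda>v. Q v = 0"] exI[of _ "1 / CARD('a)"]) auto
  qed
  then obtain B S \<theta> where geo: "singular_geometry B S \<theta>"
    and ts: "\<And>U. vec.subspace U \<Longrightarrow> totally_singular \<Phi> U = ((\<forall>u\<in>U. S u) \<and> (\<forall>u\<in>U. \<forall>v\<in>U. B u v = 0))"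
    and num: "\<theta> * ?q ^ (CARD('d) - n) = ?q powr (real n + polar_e k - 1)"
      "k = Hyperbolic \<Longrightarrow> CARD('d) = 2 * n \<and> \<theta> * ?q = 1"
    by blast
  interpret singular_geometry B S \<theta> by (rule geo)
  have ts': "totally_singular \<Phi> U \<longleftrightarrow> tot_sing U" if "vec.subspace U" for U
    unfolding ts[OF that] using that by (auto simp: tot_sing_def perp_def)
  let ?D = "{vec.dim U |U. vec.subspace U \<and> totally_singular \<Phi> U}"
  have D: "?D = vec.dim ` {U. tot_sing U}"
    using ts' tot_singD(1) by blast
  have max: "Max (vec.dim ` {U. tot_sing U}) = n" using witt D by (simp add: witt_index_def)
  have "singular_geometry_of_rank B S \<theta> n"
  proof
    show "vec.dim U \<le> n" if "tot_sing U" for U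
      unfolding max[symmetric] using that by (intro Max_ge) auto
    have "n \<in> vec.dim ` {U. tot_sing U}"
      unfolding max[symmetric] using tot_sing_zero by (intro Max_in) auto
    then show "\<exists>N. tot_sing N \<and> vec.dim N = n" by blast
  qed
  then show ?thesis using ts' num by blast
qed

section \<open>The extremal sets of flags\<close>

theorem theorem3p18:
  fixes \<Phi> :: "('a::{field,finite}, 'a ^ 'd::finite) form"
    and k :: polar_kind and n :: nat and fr :: "int \<Rightarrow> ('a ^ 'd) set" and J :: "nat set"
  assumes "classical_polar_space k n \<Phi>" and "n \<ge> 3"
    and "polar_frame \<Phi> n fr"
    and "J \<subseteq> {1..n}"
  shows
    "(\<forall>N\<in>generators \<Phi> n. 1 \<in> J \<longrightarrow>
        EKR_set \<Phi> n fr J (flags_point_in \<Phi> J N) \<and>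
        (\<not> exceptional_case k n J \<longrightarrow>
           real (card (flags_point_in \<Phi> J N)) = EKR_bound k n \<Phi> J)) \<and>
     (\<forall>P\<in>polar_points \<Phi>. n \<in> J \<and> (polar_e k \<ge> 1 \<or> even n) \<longrightarrow>
        EKR_set \<Phi> n fr J (flags_generator_through \<Phi> n J P) \<and>
        real (card (flags_generator_through \<Phi> n J P)) = EKR_bound k n \<Phi> J) \<and>
     (\<forall>K\<in>generator_classes \<Phi> n. n \<in> J \<and> polar_e k = 0 \<and> odd n \<longrightarrow>
        EKR_set \<Phi> n fr J (flags_generator_in_class \<Phi> n J K) \<and>
        real (card (flags_generator_in_class \<Phi> n J K)) = EKR_bound k n \<Phi> J)"
proof -
  let ?q = "real CARD('a)"
  note n = \<open>n \<ge> 3\<close> and frame = \<open>polar_frame \<Phi> n fr\<close> and J = \<open>J \<subseteq> {1..n}\<close>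
  obtain B S \<theta> where geo: "singular_geometry_of_rank B S \<theta> n"
    and ts: "\<And>U. vec.subspace U \<Longrightarrow> totally_singular \<Phi> U \<longleftrightarrow> singular_geometry.tot_sing B S U"
    and theta: "\<theta> * ?q ^ (CARD('d) - n) = ?q powr (real n + polar_e k - 1)"
    and hyp: "k = Hyperbolic \<Longrightarrow> CARD('d) = 2 * n \<and> \<theta> * ?q = 1"
    using classical_polar_space_geometry[OF assms(1)] by blast
  interpret singular_geometry_of_rank B S \<theta> n by (rule geo)
  have subspaces: "U \<in> polar_subspaces \<Phi> \<longleftrightarrow> tot_sing U \<and> U \<noteq> {0}" for U
    using ts[of U] tot_singD(1)[of U] by (auto simp: polar_subspaces_def)
  have nonzero: "U \<noteq> {0}" if "vec.dim U = m" "1 \<le> m" for U :: "('a ^ 'd) set" and m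
  proof
    assume "U = {0}"
    then have "m = 0" using that(1) by simp
    then show False using that(2) by simp
  qed
  have points: "P \<in> polar_points \<Phi> \<longleftrightarrow> tot_sing P \<and> vec.dim P = 1" for P
    unfolding polar_points_def subspaces mem_Collect_eq using nonzero[of P 1] by blast
  have generators: "N \<in> generators \<Phi> n \<longleftrightarrow> N \<in> gens" for N
    unfolding generators_def subspaces mem_Collect_eq gens_def using nonzero[of N n] n by force
  have flags: "flags \<Phi> J = typed_flags J"
  proof -
    have "is_flag \<Phi> f \<and> flag_type f = J \<longleftrightarrow> f \<in> typed_flags J" for f
    proof -
      have ne: "U \<noteq> {0}" if "vec.dim ` f = J" "U \<in> f" for U
      proof -
        have "vec.dim U \<in> {1..n}" using that J by blast
        then show ?thesis by (intro nonzero[OF refl]) (simp only: atLeastAtMost_iff)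
      qed
      have "f \<subseteq> polar_subspaces \<Phi> \<longleftrightarrow> (\<forall>U\<in>f. tot_sing U)" if "vec.dim ` f = J"
        using ne[OF that] subspaces by blast
      then show ?thesis
        unfolding is_flag_def flag_type_def typed_flags_def mem_Collect_eq
        by (cases "vec.dim ` f = J") simp_all
    qed
    then show ?thesis by (simp add: flags_def)
  qed
  have flag_ts: "tot_sing U" if "f \<in> typed_flags J" "U \<in> f" for f U
    using that by (simp add: typed_flags_def)
  have EKR: "EKR_set \<Phi> n fr J C"
    if "C \<subseteq> flags \<Phi> J" "\<And>f1 f2. f1 \<in> C \<Longrightarrow> f2 \<in> C \<Longrightarrow> opposite_flags \<Phi> n fr f1 f2 \<Longrightarrow> False" for C
    using that by (auto simp: EKR_set_def pairwise_def)
  have disjoint: "N1 \<inter> N2 \<subseteq> {0}" if "opposite_flags \<Phi> n fr f1 f2" "N1 \<in> f1" "N2 \<in> f2" for f1 f2 N1 N2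
    using opposite_members_disjoint[OF frame singular_geometry_axioms ts] that by blast
  have bound: "c = EKR_bound k n \<Phi> J"
    if "c * (1 + \<theta> * ?q ^ (CARD('d) - n)) = real (card (typed_flags J))" "\<not> exceptional_case k n J" for c
  proof -
    have "1 + ?q powr (real n + polar_e k - 1) > 0" by (intro add_pos_nonneg) auto
    then show ?thesis
      using that flags by (simp add: EKR_bound_def theta field_simps)
  qed
  show ?thesis
  proof (intro conjI ballI impI)
    fix N assume N: "N \<in> generators \<Phi> n" and "1 \<in> J"
    then have N': "N \<in> gens" by (simp add: generators)
    have C: "flags_point_in \<Phi> J N = {f \<in> typed_flags J. \<exists>P\<in>f. vec.dim P = 1 \<and> P \<subseteq> N}"
      unfolding flags_point_in_def flags points using flag_ts by blast
    show "EKR_set \<Phi> n fr J (flags_point_in \<Phi> J N)"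
    proof (rule EKR)
      show "flags_point_in \<Phi> J N \<subseteq> flags \<Phi> J" by (auto simp: flags_point_in_def)
      fix f1 f2 assume f: "f1 \<in> flags_point_in \<Phi> J N" "f2 \<in> flags_point_in \<Phi> J N"
        and opp: "opposite_flags \<Phi> n fr f1 f2"
      obtain P1 P2 where P: "P1 \<in> f1" "vec.dim P1 = 1" "P1 \<subseteq> N" "P2 \<in> f2" "vec.dim P2 = 1" "P2 \<subseteq> N"
        using f unfolding C by blast
      have "vec.span (P1 \<union> P2) \<subseteq> N"
        using P gensD(3)[OF N'] by (intro vec.span_minimal) auto
      then have "tot_sing (vec.span (P1 \<union> P2))"
        by (intro tot_sing_subset[OF gensD(1)[OF N']]) auto
      then have "totally_singular \<Phi> (vec.span (P1 \<union> P2))" by (simp add: ts)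
      then show False
        using opposite_points_not_collinear[OF frame _ opp P(1,2,4,5)] n by simp
    qed
    show "real (card (flags_point_in \<Phi> J N)) = EKR_bound k n \<Phi> J" if "\<not> exceptional_case k n J"
      unfolding C by (rule bound[OF card_flags_point_in_generator[OF J \<open>1 \<in> J\<close> N'] that])
  next
    fix P assume P: "P \<in> polar_points \<Phi>" and nJ: "n \<in> J \<and> (polar_e k \<ge> 1 \<or> even n)"
    have P': "tot_sing P" "vec.dim P = 1" using P points by auto
    have C: "flags_generator_through \<Phi> n J P = {f \<in> typed_flags J. \<exists>N\<in>f. vec.dim N = n \<and> P \<subseteq> N}"
      unfolding flags_generator_through_def flags generators gens_def using flag_ts by blast
    show "EKR_set \<Phi> n fr J (flags_generator_through \<Phi> n J P)"
    proof (rule EKR)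
      show "flags_generator_through \<Phi> n J P \<subseteq> flags \<Phi> J" by (auto simp: flags_generator_through_def)
      fix f1 f2 assume f: "f1 \<in> flags_generator_through \<Phi> n J P" "f2 \<in> flags_generator_through \<Phi> n J P"
        and opp: "opposite_flags \<Phi> n fr f1 f2"
      obtain N1 N2 where "N1 \<in> f1" "P \<subseteq> N1" "N2 \<in> f2" "P \<subseteq> N2"
        using f unfolding C by blast
      then have "P \<subseteq> {0}" using disjoint[OF opp] by blast
      then show False using vec.dim_subset[of P "{0}"] P'(2) by simp
    qed
    have "\<not> exceptional_case k n J" using nJ by (auto simp: exceptional_case_def)
    then show "real (card (flags_generator_through \<Phi> n J P)) = EKR_bound k n \<Phi> J"
      unfolding C using nJ by (intro bound card_flags_generator_through_point J P') auto
  next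
    fix K assume K: "K \<in> generator_classes \<Phi> n" and h: "n \<in> J \<and> polar_e k = 0 \<and> odd n"
    have k: "k = Hyperbolic" using h polar_e_eq_0_iff by blast
    interpret hyperbolic_geometry B S \<theta> n
      by unfold_locales (use n hyp[OF k] in auto)
    obtain G0 where G0: "G0 \<in> gens" and K_eq: "K = {G \<in> gens. vec.dim (G0 \<inter> G) mod 2 = n mod 2}"
      using K unfolding generator_classes_def by (auto simp: generators elim!: quotientE)
    have C: "flags_generator_in_class \<Phi> n J K = {f \<in> typed_flags J. \<exists>N\<in>f. vec.dim N = n \<and> N \<in> K}"
      unfolding flags_generator_in_class_def flags generators K_eq gens_def using flag_ts by blast
    show "EKR_set \<Phi> n fr J (flags_generator_in_class \<Phi> n J K)"
    proof (rule EKR)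
      show "flags_generator_in_class \<Phi> n J K \<subseteq> flags \<Phi> J" by (auto simp: flags_generator_in_class_def)
      fix f1 f2 assume f: "f1 \<in> flags_generator_in_class \<Phi> n J K" "f2 \<in> flags_generator_in_class \<Phi> n J K"
        and opp: "opposite_flags \<Phi> n fr f1 f2"
      obtain N1 N2 where N: "N1 \<in> f1" "N1 \<in> K" "N2 \<in> f2" "N2 \<in> K"
        using f unfolding C by blast
      then have "N1 \<inter> N2 \<subseteq> {0}" using disjoint[OF opp] by blast
      then have dim: "vec.dim (N1 \<inter> N2) = 0" using vec.dim_subset[of "N1 \<inter> N2" "{0}"] by simp
      have NK: "N1 \<in> gens" "N2 \<in> gens" "vec.dim (G0 \<inter> N1) mod 2 = n mod 2" "vec.dim (G0 \<inter> N2) mod 2 = n mod 2"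
        using N K_eq by auto
      \<comment> \<open>all three terms of this sum have the parity of \<open>n\<close>, which is odd\<close>
      have "even (vec.dim (G0 \<inter> N1) + vec.dim (G0 \<inter> N2) + n)"
        using gens_parity_triangle[OF NK(1,2) G0] unfolding dim by (simp only: add_0_right)
      moreover have "odd (a + b + n)" if "a mod 2 = n mod 2" "b mod 2 = n mod 2" for a b
      proof -
        have "odd n" using h by blast
        then show ?thesis using that by presburger
      qed
      ultimately show False using NK(3,4) by blast
    qed
    have "2 * real (card (flags_generator_in_class \<Phi> n J K)) = real (card (typed_flags J))"
      unfolding C unfolding K_eq using h by (intro card_flags_generator_in_class J G0) simp
    moreover have "exceptional_case k n J" using h by (simp add: exceptional_case_def)
    ultimately show "real (card (flags_generator_in_class \<Phi> n J K)) = EKR_bound k n \<Phi> J"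
      using h flags by (simp add: EKR_bound_def)
  qed
qed

end
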